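(* Let $G$ be a countable directed graph with no sources and no sinks and let $C^*(\mathcal{A}_G)$ be the $C^*$-algebra generated by the quiver algebra $\mathcal{A}_G$. Let $\{P'_x\}_{x\in V(G)}$ and $\{S'_e\}_{e\in E(G)}$ be families of projections and partial isometries respectively, acting on a Hilbert space $\mathcal{H}$ and satisfying the relations $(\dagger)$ for $G$. If $$\sum_{r(e)=x}S'_e(S'_e)^*\neq P'_x\qquad\text{for all }x\in V(G),$$ then there exists an injective $*$-homomorphism $\phi:C^*(\mathcal{A}_G)\to B(\mathcal{H})$ such that $\phi(L_e)=S'_e$ for all $e\in E(G)$. In particular, the $C^*$-algebra $C^*(\{S'_e\}_{e\in E(G)})$ generated by the collection $\{S'_e\}_{e\in E(G)}$ is isomorphic to $C^*(\mathcal{A}_G)$.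
   Context: $G$ is a countable directed graph with edge set $E(G)$ and vertex set $V(G)$; $s(e)$, $r(e)$ denote the source and range vertices of an edge $e$. $G$ has no sources (resp. no sinks) if every vertex is the range (resp. source) of some edge. The free semigroupoid $\mathbb{F}^+(G)$ is the set of all vertices and all finite paths $w=e_k\cdots e_1$ of $G$ (with $s(e_{i+1})=r(e_i)$, $s(w)=s(e_1)$, $r(w)=r(e_k)$, and $s(x)=r(x)=x$ for vertices), with concatenation. A family of non-zero partial isometries $\{S_e\}$ and non-zero (orthogonal) projections $\{P_x\}$ on a common Hilbert space satisfies $(\dagger)$ for $G$ if: (i) $P_xP_y=0$ for all $x\neq y$; (ii) $S_e^*S_f=0$ for all $e\neq f$; (iii) $S_e^*S_e=P_{s(e)}$ for all $e$; (iv) $\sum_{r(e)=x} S_eS_e^*\le P_x$ for all $x\in V(G)$. Infinite sums of projections converge in the strong operator topology. $\mathcal{H}_G$ is the Hilbert space with orthonormal basis $\{\xi_w : w\in\mathbb{F}^+(G)\}$; $L_e\xi_w=\xi_{ew}$ if $r(w)=s(e)$ and $0$ otherwise; $P_x$ (on $\mathcal{H}_G$) is the projection onto $\overline{\mathrm{span}}\{\xi_w:r(w)=x\}$. The quiver algebra $\mathcal{A}_G$ is the norm-closed algebra generated by $\{L_e,P_x\}$, and $C^*(\mathcal{A}_G)$ is the $C^*$-subalgebra of $B(\mathcal{H}_G)$ it generates. *)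

theory Defs
  imports "HOL-Analysis.Analysis" "Graph_Theory.Arc_Walk"
begin

section \<open>Complex Hilbert spaces\<close>

text \<open>
  A complex Hilbert space is a complete real inner product space with a compatible complex
  structure. The complex inner product is linear in its first argument, and its real part is the
  underlying real inner product, so the norm, the topology and the spaces of bounded operators
  are those of the library.
\<close>

class chilbert_space = real_inner + complete_space +
  fixes scaleC :: "complex \<Rightarrow> 'a \<Rightarrow> 'a"  (infixr \<open>*\<^sub>C\<close> 75)
    and cinner :: "'a \<Rightarrow> 'a \<Rightarrow> complex"
  assumes scaleC_add_right: "c *\<^sub>C (x + y) = c *\<^sub>C x + c *\<^sub>C y"
    and scaleC_add_left: "(c + d) *\<^sub>C x = c *\<^sub>C x + d *\<^sub>C x"
    and scaleC_scaleC: "c *\<^sub>C d *\<^sub>C x = (c * d) *\<^sub>C x"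
    and scaleC_complex_of_real: "complex_of_real r *\<^sub>C x = r *\<^sub>R x"
    and cinner_add_left: "cinner (x + y) z = cinner x z + cinner y z"
    and cinner_scaleC_left: "cinner (c *\<^sub>C x) y = c * cinner x y"
    and cinner_commute: "cinner x y = cnj (cinner y x)"
    and Re_cinner: "Re (cinner x y) = inner x y"

instance chilbert_space \<subseteq> banach ..

lemma scaleC_one: "1 *\<^sub>C x = (x :: 'a::chilbert_space)"
  using scaleC_complex_of_real[of 1 x] by simp

global_interpretation complex_vs:
  vector_space "scaleC :: complex \<Rightarrow> 'a \<Rightarrow> 'a::chilbert_space"
  defines csubspace = complex_vs.subspace
    and cspan = complex_vs.span
  by unfold_locales (auto simp: scaleC_add_right scaleC_add_left scaleC_scaleC scaleC_one)

definition orthonormal_basis :: "('i \<Rightarrow> 'a::chilbert_space) \<Rightarrow> 'i set \<Rightarrow> bool" where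
  "orthonormal_basis \<xi> I \<longleftrightarrow>
     (\<forall>v\<in>I. \<forall>w\<in>I. cinner (\<xi> v) (\<xi> w) = (if v = w then 1 else 0)) \<and>
     closure (cspan (\<xi> ` I)) = UNIV"


section \<open>Bounded operators\<close>

type_synonym 'a op = "'a \<Rightarrow>\<^sub>L 'a"

text \<open>
  The library type \<open>'a \<Rightarrow>\<^sub>L 'a\<close> consists of the bounded real-linear maps, with the operator norm;
  \<open>B(H)\<close> is the subset of complex-linear ones.
\<close>

definition bops :: "'a::chilbert_space op set" where
  "bops = {T :: 'a op. \<forall>c x. T (c *\<^sub>C x) = c *\<^sub>C T x}"

definition scale_op :: "complex \<Rightarrow> 'a::chilbert_space op \<Rightarrow> 'a op" where
  "scale_op c T = Blinfun (\<lambda>x. c *\<^sub>C T x)"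

definition adj :: "'a::chilbert_space op \<Rightarrow> 'a op" where
  "adj T = (THE R. R \<in> bops \<and> (\<forall>x y. cinner (T x) y = cinner x (R y)))"

definition positive_op :: "'a::chilbert_space op \<Rightarrow> bool" where
  "positive_op T \<longleftrightarrow> T \<in> bops \<and> (\<forall>x. Im (cinner (T x) x) = 0 \<and> 0 \<le> Re (cinner (T x) x))"

definition le_op :: "'a::chilbert_space op \<Rightarrow> 'a op \<Rightarrow> bool"  (infix \<open>\<le>\<^sub>o\<^sub>p\<close> 50) where
  "R \<le>\<^sub>o\<^sub>p T \<longleftrightarrow> positive_op (T - R)"

definition projection :: "'a::chilbert_space op \<Rightarrow> bool" where
  "projection P \<longleftrightarrow> P \<in> bops \<and> P o\<^sub>L P = P \<and> adj P = P"

definition proj_onto :: "'a::chilbert_space set \<Rightarrow> 'a op" where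
  "proj_onto M = (THE P. projection P \<and> range (blinfun_apply P) = M)"

definition partial_isometry :: "'a::chilbert_space op \<Rightarrow> bool" where
  "partial_isometry T \<longleftrightarrow> T \<in> bops \<and>
     (\<forall>x. (\<forall>y. T y = 0 \<longrightarrow> cinner x y = 0) \<longrightarrow> norm (T x) = norm x)"

text \<open>
  Sums of operators in the strong operator topology, i.e. pointwise unordered sums in the norm
  of the Hilbert space.
\<close>

definition sot_summable :: "('i \<Rightarrow> 'a::chilbert_space op) \<Rightarrow> 'i set \<Rightarrow> bool" where
  "sot_summable F I \<longleftrightarrow> (\<forall>x. (\<lambda>i. F i x) summable_on I)"

definition sot_sum :: "('i \<Rightarrow> 'a::chilbert_space op) \<Rightarrow> 'i set \<Rightarrow> 'a op" where
  "sot_sum F I = Blinfun (\<lambda>x. \<Sum>\<^sub>\<infinity>i\<in>I. F i x)"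


section \<open>Operator algebras\<close>

text \<open>Subalgebras are not required to contain the identity operator.\<close>

definition subalgebra :: "'a::chilbert_space op set \<Rightarrow> bool" where
  "subalgebra A \<longleftrightarrow> A \<subseteq> bops \<and> 0 \<in> A \<and>
     (\<forall>R\<in>A. \<forall>T\<in>A. R + T \<in> A \<and> R o\<^sub>L T \<in> A) \<and> (\<forall>c. \<forall>T\<in>A. scale_op c T \<in> A)"

definition cstar_subalgebra :: "'a::chilbert_space op set \<Rightarrow> bool" where
  "cstar_subalgebra A \<longleftrightarrow> subalgebra A \<and> closed A \<and> (\<forall>T\<in>A. adj T \<in> A)"

definition closed_algebra_gen :: "'a::chilbert_space op set \<Rightarrow> 'a op set" where
  "closed_algebra_gen X = (\<lambda>A. subalgebra A \<and> closed A) hull X"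

definition cstar_gen :: "'a::chilbert_space op set \<Rightarrow> 'a op set" where
  "cstar_gen X = cstar_subalgebra hull X"

definition star_hom ::
    "'a::chilbert_space op set \<Rightarrow> 'b::chilbert_space op set \<Rightarrow> ('a op \<Rightarrow> 'b op) \<Rightarrow> bool" where
  "star_hom A B \<phi> \<longleftrightarrow> \<phi> \<in> A \<rightarrow> B \<and>
     (\<forall>R\<in>A. \<forall>T\<in>A. \<phi> (R + T) = \<phi> R + \<phi> T \<and> \<phi> (R o\<^sub>L T) = \<phi> R o\<^sub>L \<phi> T) \<and>
     (\<forall>c. \<forall>T\<in>A. \<phi> (scale_op c T) = scale_op c (\<phi> T)) \<and>
     (\<forall>T\<in>A. \<phi> (adj T) = adj (\<phi> T))"

definition cstar_isomorphic ::
    "'a::chilbert_space op set \<Rightarrow> 'b::chilbert_space op set \<Rightarrow> bool" where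
  "cstar_isomorphic A B \<longleftrightarrow> (\<exists>\<phi>. star_hom A B \<phi> \<and> bij_betw \<phi> A B)"


section \<open>The relations for a directed graph\<close>

text \<open>Source and range of an edge \<open>e\<close> are \<open>tail G e\<close> and \<open>head G e\<close>.\<close>

definition no_sources :: "('v, 'e) pre_digraph \<Rightarrow> bool" where
  "no_sources G \<longleftrightarrow> (\<forall>x\<in>verts G. \<exists>e\<in>arcs G. head G e = x)"

definition no_sinks :: "('v, 'e) pre_digraph \<Rightarrow> bool" where
  "no_sinks G \<longleftrightarrow> (\<forall>x\<in>verts G. \<exists>e\<in>arcs G. tail G e = x)"

definition range_sum :: "('v, 'e) pre_digraph \<Rightarrow> ('e \<Rightarrow> 'a::chilbert_space op) \<Rightarrow> 'v \<Rightarrow> 'a op" where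
  "range_sum G S x = sot_sum (\<lambda>e. S e o\<^sub>L adj (S e)) {e \<in> arcs G. head G e = x}"

text \<open>
  The summability clause makes explicit that the sum in the last condition exists; by the other
  conditions it is a sum of pairwise orthogonal projections, so this is no extra restriction.
\<close>

definition dagger ::
    "('v, 'e) pre_digraph \<Rightarrow> ('e \<Rightarrow> 'a::chilbert_space op) \<Rightarrow> ('v \<Rightarrow> 'a op) \<Rightarrow> bool" where
  "dagger G S P \<longleftrightarrow>
     (\<forall>e\<in>arcs G. partial_isometry (S e) \<and> S e \<noteq> 0) \<and>
     (\<forall>x\<in>verts G. projection (P x) \<and> P x \<noteq> 0) \<and>
     (\<forall>x\<in>verts G. \<forall>y\<in>verts G. x \<noteq> y \<longrightarrow> P x o\<^sub>L P y = 0) \<and>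
     (\<forall>e\<in>arcs G. \<forall>f\<in>arcs G. e \<noteq> f \<longrightarrow> adj (S e) o\<^sub>L S f = 0) \<and>
     (\<forall>e\<in>arcs G. adj (S e) o\<^sub>L S e = P (tail G e)) \<and>
     (\<forall>x\<in>verts G. sot_summable (\<lambda>e. S e o\<^sub>L adj (S e)) {e \<in> arcs G. head G e = x} \<and>
        range_sum G S x \<le>\<^sub>o\<^sub>p P x)"


section \<open>The quiver algebra\<close>

text \<open>
  An element of the free semigroupoid is a pair of its source vertex and its list of edges in
  order of traversal: a vertex \<open>x\<close> is \<open>(x, [])\<close>, and a path \<open>e\<^sub>k \<cdots> e\<^sub>1\<close>, written as usual from
  right to left, is \<open>(tail G e\<^sub>1, [e\<^sub>1, \<dots>, e\<^sub>k])\<close>.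
\<close>

type_synonym ('v, 'e) path = "'v \<times> 'e list"

definition free_semigroupoid :: "('v, 'e) pre_digraph \<Rightarrow> ('v, 'e) path set" where
  "free_semigroupoid G = {(x, p). \<exists>y. pre_digraph.awalk G x p y}"

definition path_range :: "('v, 'e) pre_digraph \<Rightarrow> ('v, 'e) path \<Rightarrow> 'v" where
  "path_range G w = pre_digraph.awlast G (fst w) (snd w)"

definition edge_times :: "'e \<Rightarrow> ('v, 'e) path \<Rightarrow> ('v, 'e) path" where
  "edge_times e w = (fst w, snd w @ [e])"

text \<open>
  Below, \<open>\<xi>\<close> is an orthonormal basis, indexed by \<open>free_semigroupoid G\<close>, of the ambient Hilbert
  space; the pair of this space and \<open>\<xi>\<close> is \<open>\<H>\<^sub>G\<close>.
\<close>

definition creation_op ::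
    "('v, 'e) pre_digraph \<Rightarrow> (('v, 'e) path \<Rightarrow> 'a::chilbert_space) \<Rightarrow> 'e \<Rightarrow> 'a op" where
  "creation_op G \<xi> e = (THE T. T \<in> bops \<and> (\<forall>w\<in>free_semigroupoid G.
     T (\<xi> w) = (if path_range G w = tail G e then \<xi> (edge_times e w) else 0)))"

definition vertex_proj ::
    "('v, 'e) pre_digraph \<Rightarrow> (('v, 'e) path \<Rightarrow> 'a::chilbert_space) \<Rightarrow> 'v \<Rightarrow> 'a op" where
  "vertex_proj G \<xi> x =
     proj_onto (closure (cspan {\<xi> w |w. w \<in> free_semigroupoid G \<and> path_range G w = x}))"

definition quiver_algebra ::
    "('v, 'e) pre_digraph \<Rightarrow> (('v, 'e) path \<Rightarrow> 'a::chilbert_space) \<Rightarrow> 'a op set" where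
  "quiver_algebra G \<xi> =
     closed_algebra_gen (creation_op G \<xi> ` arcs G \<union> vertex_proj G \<xi> ` verts G)"

end

theory Submission
  imports Defs
begin

text \<open>
  Write \<open>L\<^sub>e\<close>, \<open>R\<^sub>x\<close> for the operators of the left regular representation on \<open>\<H>\<^sub>G\<close>, and \<open>S\<^sub>e\<close>, \<open>P\<^sub>x\<close>
  for the given family on \<open>\<H>\<close>. The multiplication rules that follow from the relations bring every
  \<open>*\<close>-polynomial in the generators to the form \<open>\<Sum> c S\<^sub>p P\<^sub>x S\<^sub>q\<^sup>*\<close>, and they are the same for both
  families. So it suffices that every such expression has the same norm in both: then the pairs of
  its two values form the graph of an isometric \<open>*\<close>-homomorphism, and the closure of that graph is
  the graph of an isomorphism of the generated \<open>C\<^sup>*\<close>-algebras (\<open>isometric_star_graph\<close>).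

  The norm on \<open>\<H>\<^sub>G\<close> is the smaller one because \<open>\<H>\<close> contains a copy of the left regular
  representation (\<open>norm_combination_op_ge\<close>). Since \<open>\<Sum> S\<^sub>e S\<^sub>e\<^sup>* \<noteq> P\<^sub>x\<close>, some unit vector \<open>\<eta>\<^sub>x\<close> in the
  range of \<open>P\<^sub>x\<close> is annihilated by all \<open>S\<^sub>e\<^sup>*\<close>. The vectors \<open>S\<^sub>p \<eta>\<^sub>x\<close> for the paths \<open>p\<close> starting at
  \<open>x\<close> are orthonormal, and \<open>\<xi>\<^sub>p \<mapsto> S\<^sub>p \<eta>\<^sub>x\<close> is an isometry that intertwines \<open>L\<^sub>e\<close> with \<open>S\<^sub>e\<close> and
  \<open>L\<^sub>e\<^sup>*\<close> with \<open>S\<^sub>e\<^sup>*\<close>.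

  The norm on \<open>\<H>\<^sub>G\<close> is the larger one for every family satisfying the relations
  (\<open>norm_combination_op_le\<close>), by means of the Poisson kernel
    \<open>K h = \<Sum>\<^sub>w r\<^bsup>|w|\<^esup> \<xi>\<^sub>w \<otimes> \<Delta> S\<^sub>w\<^sup>* h\<close>, where \<open>0 \<le> r < 1\<close> and \<open>\<Delta>\<^sup>2 = 1 - r\<^sup>2 \<Sum> S\<^sub>e S\<^sub>e\<^sup>*\<close>.
  It is contractive and satisfies \<open>(L\<^sub>e\<^sup>* \<otimes> 1) K = r K S\<^sub>e\<^sup>*\<close>, and \<open>K\<^sup>* K\<close> acts as the identity on the
  ranges of the \<open>P\<^sub>x\<close>. Hence \<open>K\<^sup>* (L\<^sub>p R\<^sub>x L\<^sub>q\<^sup>* \<otimes> 1) K = r\<^bsup>|p|+|q|\<^esup> S\<^sub>p P\<^sub>x S\<^sub>q\<^sup>*\<close>, and the estimate follows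
  for \<open>r \<rightarrow> 1\<close>. A single polynomial involves only finitely many edges, so the kernel may be
  restricted to paths in a finite set of edges and truncated to paths of length less than \<open>n\<close>, at
  the cost of an error of order \<open>r\<^bsup>2n\<^esup>\<close>. Then only finitely many vectors of \<open>\<H>\<close> occur, and
  coordinates with respect to a finite orthonormal set \<open>B\<close> turn an element of \<open>\<H>\<^sub>G \<otimes> \<H>\<close> into a
  family of vectors of \<open>\<H>\<^sub>G\<close> indexed by \<open>B\<close>.
\<close>


section \<open>Complex inner products and adjoints\<close>

text \<open>
  The complex inner product is determined by its real part, so an identity for it follows from the
  same identity for the real inner product.
\<close>

lemma cinner_eq: "cinner x y = Complex (inner x y) (inner ((- \<i>) *\<^sub>C x) y)"
proof -
  have "Im (cinner x y) = Re (cinner ((- \<i>) *\<^sub>C x) y)"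
    unfolding cinner_scaleC_left by simp
  then show ?thesis
    by (simp add: complex_eq_iff Re_cinner)
qed

lemma scaleC_zero_right [simp]: "c *\<^sub>C (0 :: 'a::chilbert_space) = 0"
  by (rule complex_vs.scale_zero_right)

lemma scaleC_zero_left [simp]: "0 *\<^sub>C (x :: 'a::chilbert_space) = 0"
  by (rule complex_vs.scale_zero_left)

lemma cinner_zero_left [simp]: "cinner 0 y = 0"
  using cinner_scaleC_left[of 0 0 y] by simp

lemma cinner_zero_right [simp]: "cinner y 0 = 0"
  by (subst cinner_commute) simp

lemma cinner_add_right: "cinner x (y + z) = cinner x y + cinner x z"
  by (subst (1 2 3) cinner_commute) (simp add: cinner_add_left)

lemma cinner_scaleC_right: "cinner x (c *\<^sub>C y) = cnj c * cinner x y"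
  by (subst (1 2) cinner_commute) (simp add: cinner_scaleC_left)

lemma scaleR_eq_scaleC: "r *\<^sub>R x = complex_of_real r *\<^sub>C x"
  by (simp add: scaleC_complex_of_real)

lemma cinner_scaleR_left: "cinner (r *\<^sub>R x) y = r * cinner x y"
  by (simp add: scaleR_eq_scaleC cinner_scaleC_left)

lemma cinner_scaleR_right: "cinner x (r *\<^sub>R y) = r * cinner x y"
  by (simp add: scaleR_eq_scaleC cinner_scaleC_right)

lemma cinner_minus_left: "cinner (- x) y = - cinner x y"
  using cinner_scaleR_left[of "-1" x y] by simp

lemma cinner_minus_right: "cinner x (- y) = - cinner x y"
  using cinner_scaleR_right[of x "-1" y] by simp

lemma cinner_diff_left: "cinner (x - z) y = cinner x y - cinner z y"
  using cinner_add_left[of x "- z" y] by (simp add: cinner_minus_left)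

lemma cinner_diff_right: "cinner x (y - z) = cinner x y - cinner x z"
  using cinner_add_right[of x y "- z"] by (simp add: cinner_minus_right)

lemma cinner_sum_left: "cinner (\<Sum>i\<in>I. f i) y = (\<Sum>i\<in>I. cinner (f i) y)"
  by (induction I rule: infinite_finite_induct) (auto simp: cinner_add_left)

lemma cinner_sum_right: "cinner x (\<Sum>i\<in>I. f i) = (\<Sum>i\<in>I. cinner x (f i))"
  by (induction I rule: infinite_finite_induct) (auto simp: cinner_add_right)

lemma cinner_self: "cinner x x = complex_of_real ((norm x)\<^sup>2)"
proof -
  have "cinner x x = cnj (cinner x x)"
    by (rule cinner_commute)
  then have "Im (cinner x x) = 0"
    by (metis cnj.simps(2) complex_eq_iff neg_equal_zero)
  moreover have "Re (cinner x x) = (norm x)\<^sup>2"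
    by (simp add: Re_cinner power2_norm_eq_inner)
  ultimately show ?thesis
    by (simp add: complex_eq_iff)
qed

lemma norm_eq_oneI:
  assumes "cinner x x = 1"
  shows "norm x = 1"
proof -
  have "complex_of_real ((norm x)\<^sup>2) = complex_of_real 1"
    using assms by (simp only: cinner_self of_real_1)
  then have "(norm x)\<^sup>2 = 1\<^sup>2"
    by (simp only: of_real_eq_iff one_power2)
  then show ?thesis
    by (rule power2_eq_imp_eq) simp_all
qed

lemma norm_scaleC: "norm (c *\<^sub>C x) = cmod c * norm (x :: 'a::chilbert_space)"
proof -
  have "complex_of_real ((norm (c *\<^sub>C x))\<^sup>2) = c * (cnj c * cinner x x)"
    by (simp only: cinner_self[symmetric]) (simp add: cinner_scaleC_left cinner_scaleC_right)
  also have "\<dots> = complex_of_real ((cmod c * norm x)\<^sup>2)"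
    by (simp only: cinner_self mult.assoc[symmetric] complex_norm_square[symmetric] of_real_mult
        power_mult_distrib)
  finally have "(norm (c *\<^sub>C x))\<^sup>2 = (cmod c * norm x)\<^sup>2"
    using of_real_eq_iff by blast
  then show ?thesis
    by (simp add: power2_eq_iff_nonneg)
qed

lemma cmod_cinner_le: "cmod (cinner x y) \<le> norm x * norm y"
proof (cases "cinner x y = 0")
  case False
  \<comment> \<open>Rotating \<open>x\<close> by a unimodular scalar makes the inner product real.\<close>
  define u where "u = cnj (cinner x y) / cmod (cinner x y)"
  have u: "cmod u = 1"
    using False by (simp add: u_def norm_divide)
  have "u * cinner x y = cmod (cinner x y)"
    using False complex_norm_square[of "cinner x y"]
    by (simp add: u_def mult.commute power2_eq_square divide_simps)
  then have "cmod (cinner x y) = inner (u *\<^sub>C x) y"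
    by (metis Re_cinner Re_complex_of_real cinner_scaleC_left)
  also have "\<dots> \<le> norm (u *\<^sub>C x) * norm y"
    by (rule norm_cauchy_schwarz)
  finally show ?thesis
    by (simp add: norm_scaleC u)
qed auto

lemma bounded_linear_cinner_left: "bounded_linear (\<lambda>x. cinner x y)"
  by (rule bounded_linear_intro[where K = "norm y"])
    (auto simp: cinner_add_left cinner_scaleR_left cmod_cinner_le scaleR_conv_of_real)

lemma bounded_linear_cinner_right: "bounded_linear (\<lambda>y. cinner x y)"
  by (rule bounded_linear_intro[where K = "norm x"])
    (auto simp: cinner_add_right cinner_scaleR_right scaleR_conv_of_real
      intro: order_trans[OF cmod_cinner_le])

lemma bounded_linear_scaleC: "bounded_linear (\<lambda>x. c *\<^sub>C (x :: 'a::chilbert_space))"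
  by (rule bounded_linear_intro[where K = "cmod c"])
    (auto simp: scaleC_add_right scaleR_eq_scaleC scaleC_scaleC norm_scaleC mult.commute)

lemma cinner_eqI: "x = y" if "\<And>z. cinner z x = cinner z y"
proof -
  have "cinner (x - y) (x - y) = 0"
    by (simp add: cinner_diff_right that)
  then show ?thesis
    by (simp add: cinner_self)
qed

text \<open>
  A sequence minimizing \<open>\<parallel>x\<parallel>\<^sup>2 - 2 f x\<close> is Cauchy by the parallelogram law, and the minimality of its
  limit \<open>y\<close> along each line \<open>y + t z\<close> says that \<open>f\<close> is the inner product with \<open>y\<close>.
\<close>

lemma riesz_representation:
  fixes f :: "'a::{real_inner, complete_space} \<Rightarrow> real"
  assumes f: "bounded_linear f"
  obtains y where "\<And>x. f x = inner x y"
proof -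
  interpret f: bounded_linear f by fact
  define J where "J x = (norm x)\<^sup>2 - 2 * f x" for x
  obtain K where K: "\<And>x. \<bar>f x\<bar> \<le> norm x * K"
    using f.bounded by auto
  have J_bound: "- K\<^sup>2 \<le> J x" for x
  proof -
    have "0 \<le> (norm x - K)\<^sup>2"
      by simp
    then show ?thesis
      using K[of x] by (simp add: J_def power2_diff)
  qed
  define m where "m = Inf (range J)"
  have m_le: "m \<le> J x" for x
    unfolding m_def by (rule cInf_lower) (auto intro!: bdd_belowI2 J_bound)
  have "\<exists>x. J x < m + 1 / Suc n" for n
    using cInf_lessD[of "range J" "m + 1 / Suc n"] unfolding m_def by auto
  then obtain x where x: "\<And>n. J (x n) < m + 1 / Suc n"
    by metis
  have para: "(norm (a - b))\<^sup>2 = 2 * J a + 2 * J b - 4 * J ((1/2) *\<^sub>R (a + b))" for a b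
    by (simp add: J_def power2_norm_eq_inner inner_simps f.add f.scaleR inner_commute field_simps)
  have dist: "(norm (x k - x l))\<^sup>2 < 4 / Suc N" if "N \<le> k" "N \<le> l" for k l N
  proof -
    have "1 / Suc k \<le> 1 / real (Suc N)" "1 / Suc l \<le> 1 / real (Suc N)"
      using that by (simp_all add: field_simps)
    then show ?thesis
      using para[of "x k" "x l"] m_le[of "(1/2) *\<^sub>R (x k + x l)"] x[of k] x[of l]
      by linarith
  qed
  have "Cauchy x"
  proof (rule metric_CauchyI)
    fix e :: real assume "0 < e"
    then obtain N where N: "4 / real (Suc N) < e\<^sup>2"
      using reals_Archimedean[of "e\<^sup>2 / 4"] by (auto simp: field_simps inverse_eq_divide)
    have "dist (x k) (x l) < e" if "N \<le> k" "N \<le> l" for k l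
    proof (rule power_less_imp_less_base)
      show "(dist (x k) (x l))\<^sup>2 < e\<^sup>2"
        using dist[OF that] N by (simp add: dist_norm)
    qed (use \<open>0 < e\<close> in auto)
    then show "\<exists>M. \<forall>m\<ge>M. \<forall>n\<ge>M. dist (x m) (x n) < e"
      by blast
  qed
  then obtain y where y: "x \<longlonglongrightarrow> y"
    using Cauchy_convergent_iff convergent_def by blast
  have "(\<lambda>n. J (x n)) \<longlonglongrightarrow> J y"
    unfolding J_def by (intro tendsto_intros y f.tendsto)
  moreover have "(\<lambda>n. m + 1 / Suc n) \<longlonglongrightarrow> m + 0"
    by (intro tendsto_intros LIMSEQ_Suc[OF lim_1_over_n])
  ultimately have "J y \<le> m + 0"
    by (rule LIMSEQ_le) (use x less_imp_le in blast)
  then have Jy: "J y \<le> m"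
    by simp
  have "f z = inner z y" for z
  proof -
    define d where "d = f z - inner z y"
    have "J (y + t *\<^sub>R z) = J y + t * t * (norm z)\<^sup>2 - 2 * t * d" for t
      by (simp add: J_def d_def power2_norm_eq_inner inner_simps f.add f.scaleR inner_commute
          algebra_simps)
    then have "0 \<le> t * t * (norm z)\<^sup>2 - 2 * t * d" for t
      using m_le[of "y + t *\<^sub>R z"] Jy by simp
    moreover define t where "t = d / ((norm z)\<^sup>2 + 1)"
    moreover have d: "d = t * ((norm z)\<^sup>2 + 1)"
      by (simp add: t_def add_nonneg_eq_0_iff)
    ultimately have "0 \<le> t * t * (norm z)\<^sup>2 - 2 * t * (t * ((norm z)\<^sup>2 + 1))"
      by metis
    then have "(t * t) * ((norm z)\<^sup>2 + 2) \<le> 0"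
      by (simp add: algebra_simps)
    then have "t = 0"
      by (simp add: mult_le_0_iff add_nonneg_eq_0_iff) (smt (verit) zero_le_power2)
    with d have "d = 0"
      by simp
    then show ?thesis
      by (simp add: d_def)
  qed
  then show ?thesis
    using that by blast
qed

lemma bopsD: "T \<in> bops \<Longrightarrow> T (c *\<^sub>C x) = c *\<^sub>C T x"
  by (simp add: bops_def)

lemma scale_op_apply [simp]: "scale_op c T x = c *\<^sub>C T x"
  unfolding scale_op_def
  by (simp add: bounded_linear_Blinfun_apply bounded_linear_compose[OF bounded_linear_scaleC]
      blinfun.bounded_linear_right)

lemma bops_zero [simp]: "0 \<in> bops"
  by (simp add: bops_def)

lemma bops_add: "R \<in> bops \<Longrightarrow> T \<in> bops \<Longrightarrow> R + T \<in> bops"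
  by (simp add: bops_def blinfun.add_left scaleC_add_right)

lemma bops_scale: "T \<in> bops \<Longrightarrow> scale_op c T \<in> bops"
  by (simp add: bops_def scaleC_scaleC mult.commute)

lemma bops_compose: "R \<in> bops \<Longrightarrow> T \<in> bops \<Longrightarrow> R o\<^sub>L T \<in> bops"
  by (simp add: bops_def)

lemma bops_sum: "(\<And>i. i \<in> I \<Longrightarrow> F i \<in> bops) \<Longrightarrow> (\<Sum>i\<in>I. F i) \<in> bops"
  by (induction I rule: infinite_finite_induct) (auto intro: bops_add)

lemma scale_op_add: "scale_op c (R + T) = scale_op c R + scale_op c T"
  by (auto intro!: blinfun_eqI simp: blinfun.add_left scaleC_add_right)

lemma scale_op_scale_op: "scale_op c (scale_op d T) = scale_op (c * d) T"
  by (auto intro!: blinfun_eqI)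

lemma scale_op_one: "scale_op 1 T = T"
  by (auto intro!: blinfun_eqI simp: scaleC_one)

lemma bounded_linear_scale_op: "bounded_linear (scale_op c)"
proof (rule bounded_linear_intro)
  fix T U :: "'a::chilbert_space op" and a :: real
  show "scale_op c (T + U) = scale_op c T + scale_op c U"
    by (rule scale_op_add)
  show "scale_op c (a *\<^sub>R T) = a *\<^sub>R scale_op c T"
    by (auto intro!: blinfun_eqI simp: blinfun.scaleR_left scaleR_eq_scaleC mult.commute)
  show "norm (scale_op c T) \<le> norm T * cmod c"
  proof (rule norm_blinfun_bound)
    fix v
    have "cmod c * norm (T v) \<le> cmod c * (norm T * norm v)"
      by (intro mult_left_mono norm_blinfun) simp
    then show "norm (scale_op c T v) \<le> norm T * cmod c * norm v"
      by (simp add: norm_scaleC mult_ac)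
  qed simp
qed

lemma compose_scale: "A o\<^sub>L scale_op c T = scale_op c (A o\<^sub>L T)" if "A \<in> bops"
  using that by (auto intro!: blinfun_eqI simp: bopsD)

lemma scale_compose: "scale_op c T o\<^sub>L A = scale_op c (T o\<^sub>L A)"
  by (auto intro!: blinfun_eqI)

lemma blinfun_compose_assoc: "(A o\<^sub>L B) o\<^sub>L C = A o\<^sub>L (B o\<^sub>L C)"
  by (auto intro!: blinfun_eqI)

lemma blinfun_compose_add_left: "(A + B) o\<^sub>L C = (A o\<^sub>L C) + (B o\<^sub>L C)"
  by (auto intro!: blinfun_eqI simp: blinfun.add_left)

lemma blinfun_compose_add_right: "A o\<^sub>L (B + C) = (A o\<^sub>L B) + (A o\<^sub>L C)"
  by (auto intro!: blinfun_eqI simp: blinfun.add_left blinfun.add_right)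

lemma id_blinfun_compose [simp]: "id_blinfun o\<^sub>L T = T"
  by (auto intro!: blinfun_eqI)

lemma id_bops: "id_blinfun \<in> bops"
  by (simp add: bops_def)

lemma scale_op_minus_one: "scale_op (- 1) T = - T"
  using scaleR_eq_scaleC[of "- 1"] by (auto intro!: blinfun_eqI simp: blinfun.minus_left)

lemma bops_uminus: "T \<in> bops \<Longrightarrow> - T \<in> bops"
  using bops_scale[of T "- 1"] by (simp add: scale_op_minus_one)

lemma bops_diff: "R \<in> bops \<Longrightarrow> T \<in> bops \<Longrightarrow> R - T \<in> bops"
  using bops_add[of R "- T"] bops_uminus[of T] by simp

lemma closed_bops: "closed bops"
proof -
  have "bops = (\<Inter>c. \<Inter>x. {T :: 'a op. T (c *\<^sub>C x) = c *\<^sub>C T x})"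
    by (auto simp: bops_def)
  moreover have "closed \<dots>"
    by (intro closed_INT ballI closed_Collect_eq continuous_intros
        bounded_linear.continuous_on[OF bounded_linear_scaleC])
  ultimately show ?thesis
    by simp
qed

text \<open>
  The adjoint with respect to the real inner product is also one for the complex inner product,
  which makes it complex linear.
\<close>

lemma adjoint_exists:
  assumes T: "T \<in> bops"
  obtains R where "R \<in> bops" "\<And>x y. cinner (T x) y = cinner x (R y)" "norm R \<le> norm T"
proof -
  have "\<exists>z. \<forall>x. inner (T x) y = inner x z" for y
    by (rule riesz_representation[of "\<lambda>x. inner (T x) y"])
      (auto intro: bounded_linear_compose[OF bounded_linear_inner_left blinfun.bounded_linear_right])
  then obtain r where r: "\<And>x y. inner (T x) y = inner x (r y)"
    by metis
  have cr: "cinner (T x) y = cinner x (r y)" for x y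
    by (simp add: cinner_eq bopsD[OF T, symmetric] r)
  have add: "r (x + y) = r x + r y" for x y
    by (rule cinner_eqI) (simp add: cr[symmetric] cinner_add_right)
  have sc: "r (c *\<^sub>C x) = c *\<^sub>C r x" for c x
    by (rule cinner_eqI) (simp add: cr[symmetric] cinner_scaleC_right)
  have bd: "norm (r y) \<le> norm T * norm y" for y
  proof (cases "r y = 0")
    case False
    have "norm (r y) * norm (r y) = inner (T (r y)) y"
      by (simp add: r power2_norm_eq_inner[symmetric] power2_eq_square)
    also have "\<dots> \<le> norm (T (r y)) * norm y"
      by (rule norm_cauchy_schwarz)
    also have "\<dots> \<le> (norm T * norm (r y)) * norm y"
      by (intro mult_right_mono norm_blinfun) auto
    finally show ?thesis
      using False by (simp add: mult_ac)
  qed auto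
  have bl: "bounded_linear r"
    by (rule bounded_linear_intro[where K = "norm T"])
      (use bd add sc in \<open>auto simp: scaleR_eq_scaleC mult.commute\<close>)
  show ?thesis
  proof
    show "Blinfun r \<in> bops" "norm (Blinfun r) \<le> norm T"
      using sc bd by (auto simp: bops_def bounded_linear_Blinfun_apply[OF bl] intro!: norm_blinfun_bound)
    show "cinner (T x) y = cinner x (Blinfun r y)" for x y
      by (simp add: bounded_linear_Blinfun_apply[OF bl] cr)
  qed
qed

lemma adj_eqI:
  fixes R T :: "'a::chilbert_space op"
  assumes "R \<in> bops" "\<And>x y. cinner (T x) y = cinner x (R y)"
  shows "adj T = R"
  unfolding adj_def
proof (rule the_equality)
  fix R' assume "R' \<in> bops \<and> (\<forall>x y. cinner (T x) y = cinner x (R' y))"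
  then show "R' = R"
    by (intro blinfun_eqI cinner_eqI) (simp flip: assms(2))
qed (use assms in simp)

lemma
  assumes T: "T \<in> bops"
  shows adj_bops: "adj T \<in> bops"
    and cinner_adj_right: "cinner x (adj T y) = cinner (T x) y"
    and norm_adj_le: "norm (adj T) \<le> norm T"
proof -
  obtain R where R: "R \<in> bops" "\<And>x y. cinner (T x) y = cinner x (R y)" "norm R \<le> norm T"
    using adjoint_exists[OF T] by blast
  have "adj T = R"
    using R(1,2) by (rule adj_eqI)
  with R show "adj T \<in> bops" "cinner x (adj T y) = cinner (T x) y" "norm (adj T) \<le> norm T"
    by simp_all
qed

lemma cinner_adj_left: "T \<in> bops \<Longrightarrow> cinner (adj T x) y = cinner x (T y)"
  by (subst (1 2) cinner_commute) (simp add: cinner_adj_right)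

lemma adj_adj: "T \<in> bops \<Longrightarrow> adj (adj T) = T"
  by (intro adj_eqI) (auto simp: cinner_adj_left)

lemma adj_add: "R \<in> bops \<Longrightarrow> T \<in> bops \<Longrightarrow> adj (R + T) = adj R + adj T"
  by (intro adj_eqI bops_add adj_bops)
    (auto simp: cinner_adj_right blinfun.add_left cinner_add_left cinner_add_right)

lemma adj_scale: "T \<in> bops \<Longrightarrow> adj (scale_op c T) = scale_op (cnj c) (adj T)"
  by (intro adj_eqI bops_scale adj_bops)
    (auto simp: cinner_adj_right cinner_scaleC_left cinner_scaleC_right)

lemma adj_diff: "R \<in> bops \<Longrightarrow> T \<in> bops \<Longrightarrow> adj (R - T) = adj R - adj T"
  by (intro adj_eqI bops_diff adj_bops)
    (auto simp: cinner_adj_right blinfun.diff_left cinner_diff_left cinner_diff_right)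

lemma tendsto_adj:
  assumes "\<And>n. f n \<in> bops" "T \<in> bops" "f \<longlonglongrightarrow> T"
  shows "(\<lambda>n. adj (f n)) \<longlonglongrightarrow> adj T"
proof -
  have lim: "(\<lambda>n. norm (f n - T)) \<longlonglongrightarrow> 0"
    using assms(3) by (simp add: LIM_zero tendsto_norm_zero)
  have "norm (adj (f n) - adj T) \<le> norm (f n - T)" for n
    using norm_adj_le[OF bops_diff[OF assms(1)[of n] assms(2)]] adj_diff[OF assms(1)[of n] assms(2)]
    by simp
  from Lim_null_comparison[OF always_eventually[OF allI[OF this]] lim]
  have "(\<lambda>n. adj (f n) - adj T) \<longlonglongrightarrow> 0" .
  then show ?thesis
    by (rule LIM_zero_cancel)
qed

lemma adj_compose: "R \<in> bops \<Longrightarrow> T \<in> bops \<Longrightarrow> adj (R o\<^sub>L T) = adj T o\<^sub>L adj R"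
  by (intro adj_eqI bops_compose adj_bops) (auto simp: cinner_adj_right)

lemma adj_zero [simp]: "adj 0 = 0"
  by (intro adj_eqI) auto

lemma adj_id: "adj id_blinfun = id_blinfun"
  by (intro adj_eqI id_bops) simp

lemma projectionD:
  assumes "projection P"
  shows "P \<in> bops" "P (P x) = P x" "adj P = P"
  using assms by (auto simp: projection_def blinfun_apply_blinfun_compose[symmetric]
      simp del: blinfun_apply_blinfun_compose)

lemma projection_cinner:
  assumes "projection P"
  shows "cinner (P x) y = cinner x (P y)" "cinner (P x) (P y) = cinner (P x) y"
proof -
  show *: "cinner (P x) y = cinner x (P y)" for y
    using cinner_adj_left[of P x y] projectionD[OF assms] by simp
  show "cinner (P x) (P y) = cinner (P x) y"
    using *[of "P y"] *[of y] projectionD[OF assms] by simp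
qed

lemma projection_norm_le: "projection P \<Longrightarrow> norm (P x) \<le> norm x"
proof (cases "P x = 0")
  case False
  assume "projection P"
  then have "complex_of_real (norm (P x) * norm (P x)) = cinner (P x) x"
    by (simp add: projection_cinner(2)[symmetric] cinner_self power2_eq_square)
  then have "norm (P x) * norm (P x) = cmod (cinner (P x) x)"
    by (metis abs_of_nonneg norm_of_real zero_le_square)
  also have "\<dots> \<le> norm (P x) * norm x"
    by (rule cmod_cinner_le)
  finally show ?thesis
    using False by simp
qed auto

lemma projection_eqI:
  assumes "projection P" "projection R" "range (blinfun_apply P) = range (blinfun_apply R)"
  shows "P = R"
proof (rule blinfun_eqI)
  fix x
  have PR: "P (R y) = R y" and RP: "R (P y) = P y" for y
    using assms(3) projectionD(2)[OF assms(1)] projectionD(2)[OF assms(2)]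
    by (metis rangeE rangeI)+
  show "P x = R x"
  proof (rule cinner_eqI)
    fix z
    have "cinner z (P x) = cinner (R (P z)) x"
      by (simp add: RP projection_cinner(1)[OF assms(1)])
    also have "\<dots> = cinner z (R x)"
      by (simp add: projection_cinner(1)[OF assms(1)] projection_cinner(1)[OF assms(2)] PR)
    finally show "cinner z (P x) = cinner z (R x)" .
  qed
qed


section \<open>Extension by continuity along graphs\<close>

text \<open>
  A densely defined contraction is extended by closing its graph. Since the graph carries all the
  algebraic structure, the closure of the graph of an isometric \<open>*\<close>-homomorphism is again one, and
  no choice of extension has to be made before its properties are proved.
\<close>

lemma contraction_graph_closure:
  fixes \<Gamma> :: "('a::real_normed_vector \<times> 'b::banach) set"
  assumes diff: "\<And>p q. p \<in> \<Gamma> \<Longrightarrow> q \<in> \<Gamma> \<Longrightarrow> p - q \<in> \<Gamma>"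
    and le: "\<And>x y. (x, y) \<in> \<Gamma> \<Longrightarrow> norm y \<le> norm x"
  shows "(x, y) \<in> closure \<Gamma> \<Longrightarrow> norm y \<le> norm x"
    and "x \<in> closure (fst ` \<Gamma>) \<Longrightarrow> \<exists>y. (x, y) \<in> closure \<Gamma>"
proof -
  assume "(x, y) \<in> closure \<Gamma>"
  then obtain p where p: "\<And>n. p n \<in> \<Gamma>" "p \<longlonglongrightarrow> (x, y)"
    by (auto simp: closure_sequential)
  have "(\<lambda>n. norm (snd (p n))) \<longlonglongrightarrow> norm y" "(\<lambda>n. norm (fst (p n))) \<longlonglongrightarrow> norm x"
    using tendsto_snd[OF p(2)] tendsto_fst[OF p(2)] by (auto intro: tendsto_norm)
  moreover have "norm (snd (p n)) \<le> norm (fst (p n))" for n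
    using p(1)[of n] le by (metis prod.collapse)
  ultimately show "norm y \<le> norm x"
    by (meson LIMSEQ_le)
next
  assume "x \<in> closure (fst ` \<Gamma>)"
  then obtain a where "\<And>n. a n \<in> fst ` \<Gamma>" and a: "a \<longlonglongrightarrow> x"
    by (auto simp: closure_sequential)
  then have "\<exists>b. (a n, b) \<in> \<Gamma>" for n
    by (metis imageE prod.collapse)
  then obtain b where ab: "\<And>n. (a n, b n) \<in> \<Gamma>"
    by metis
  have *: "dist (b m) (b n) \<le> dist (a m) (a n)" for m n
    using le diff[OF ab ab, of m n] by (simp add: dist_norm)
  have "Cauchy a"
    using a by (rule LIMSEQ_imp_Cauchy)
  then have "Cauchy b"
    unfolding Cauchy_def using * by (meson le_less_trans)
  then obtain y where "b \<longlonglongrightarrow> y"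
    using Cauchy_convergent_iff convergent_def by blast
  then have "(\<lambda>n. (a n, b n)) \<longlonglongrightarrow> (x, y)"
    using a by (intro tendsto_Pair)
  then show "\<exists>y. (x, y) \<in> closure \<Gamma>"
    unfolding closure_sequential using ab by (intro exI[of _ y] exI[of _ "\<lambda>n. (a n, b n)"]) simp
qed

lemma closure_mono_map:
  assumes "p \<in> closure A" "continuous_on UNIV f" "\<And>p. p \<in> A \<Longrightarrow> f p \<in> closure B"
  shows "f p \<in> closure B"
proof -
  have "f ` closure A \<subseteq> closure B"
    by (rule image_closure_subset)
      (use assms in \<open>auto intro: continuous_on_subset\<close>)
  with assms(1) show ?thesis
    by blast
qed

lemma closure_closed_under:
  assumes "p \<in> closure A" "q \<in> closure A" "continuous_on UNIV (\<lambda>(p, q). f p q)"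
    and "\<And>p q. p \<in> A \<Longrightarrow> q \<in> A \<Longrightarrow> f p q \<in> A"
  shows "f p q \<in> closure A"
proof -
  have "(p, q) \<in> closure (A \<times> A)"
    using assms(1,2) by (simp add: closure_Times)
  from closure_mono_map[OF this assms(3), of A] show ?thesis
    using assms(4) closure_subset by fastforce
qed


lemma csubspace_closure:
  assumes "csubspace (A :: 'a::chilbert_space set)"
  shows "csubspace (closure A)"
  unfolding complex_vs.subspace_def
proof (intro conjI allI impI ballI)
  show "0 \<in> closure A"
    using complex_vs.subspace_0[OF assms] by (rule subsetD[OF closure_subset])
  show "x + y \<in> closure A" if "x \<in> closure A" "y \<in> closure A" for x y
    by (rule closure_closed_under[OF that])
      (auto simp: case_prod_beta intro!: continuous_intros complex_vs.subspace_add[OF assms])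
  show "c *\<^sub>C x \<in> closure A" if "x \<in> closure A" for c x
  proof (rule closure_mono_map[OF that])
    show "continuous_on UNIV (\<lambda>x::'a. c *\<^sub>C x)"
      by (intro bounded_linear.continuous_on[OF bounded_linear_scaleC] continuous_intros)
    show "c *\<^sub>C p \<in> closure A" if "p \<in> A" for p
      by (rule subsetD[OF closure_subset complex_vs.subspace_scale[OF assms that]])
  qed
qed


section \<open>Orthonormal bases\<close>

text \<open>
  The analogue of \<open>bops\<close> for maps between two Hilbert spaces.
\<close>

definition complex_linear :: "('a::chilbert_space \<Rightarrow>\<^sub>L 'b::chilbert_space) \<Rightarrow> bool" where
  "complex_linear T \<longleftrightarrow> (\<forall>c x. T (c *\<^sub>C x) = c *\<^sub>C T x)"

lemma complex_linear_iff_bops: "complex_linear T \<longleftrightarrow> T \<in> bops"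
  by (simp add: complex_linear_def bops_def)

lemma orthonormal_basis_total:
  assumes "orthonormal_basis \<xi> I" "closed S" "csubspace S" "\<And>i. i \<in> I \<Longrightarrow> \<xi> i \<in> S"
  shows "x \<in> S"
proof -
  have "cspan (\<xi> ` I) \<subseteq> S"
    using assms(3,4) by (intro complex_vs.span_minimal) auto
  then have "closure (cspan (\<xi> ` I)) \<subseteq> S"
    using assms(2) by (rule closure_minimal)
  with assms(1) show ?thesis
    by (auto simp: orthonormal_basis_def)
qed

lemma basis_eqI:
  fixes T R :: "'a::chilbert_space \<Rightarrow>\<^sub>L 'b::chilbert_space"
  assumes \<xi>: "orthonormal_basis \<xi> I" and "complex_linear T" "complex_linear R"
    and "\<And>i. i \<in> I \<Longrightarrow> T (\<xi> i) = R (\<xi> i)"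
  shows "T = R"
proof (rule blinfun_eqI)
  fix x
  have "x \<in> {x. T x = R x}"
  proof (rule orthonormal_basis_total[OF \<xi>])
    show "closed {x. T x = R x}"
      by (intro closed_Collect_eq continuous_intros)
    show "csubspace {x. T x = R x}"
      using assms(2,3) by (auto simp: complex_vs.subspace_def complex_linear_def blinfun.add_right)
  qed (use assms(4) in auto)
  then show "T x = R x"
    by simp
qed

lemma cinner_basis_eqI:
  fixes A C :: "'k::chilbert_space \<Rightarrow>\<^sub>L 'h::chilbert_space" and B D :: "'k \<Rightarrow>\<^sub>L 'm::chilbert_space"
  assumes \<xi>: "orthonormal_basis \<xi> I"
    and lin: "complex_linear A" "complex_linear B" "complex_linear C" "complex_linear D"
    and eq: "\<And>i j. i \<in> I \<Longrightarrow> j \<in> I \<Longrightarrow>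
      cinner (A (\<xi> i)) (C (\<xi> j)) = cinner (B (\<xi> i)) (D (\<xi> j))"
  shows "cinner (A x) (C y) = cinner (B x) (D y)"
proof -
  note cont = bounded_linear.continuous_on[OF bounded_linear_cinner_left]
    bounded_linear.continuous_on[OF bounded_linear_cinner_right]
  note lin' = lin[unfolded complex_linear_def, rule_format]
  have "y \<in> {y. cinner (A (\<xi> i)) (C y) = cinner (B (\<xi> i)) (D y)}" if "i \<in> I" for i y
  proof (rule orthonormal_basis_total[OF \<xi>])
    show "closed {y. cinner (A (\<xi> i)) (C y) = cinner (B (\<xi> i)) (D y)}"
      by (intro closed_Collect_eq cont continuous_intros)
    show "csubspace {y. cinner (A (\<xi> i)) (C y) = cinner (B (\<xi> i)) (D y)}"
      by (auto simp: complex_vs.subspace_def lin' blinfun.add_right cinner_add_right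
          cinner_scaleC_right)
  qed (use eq that in auto)
  then have *: "cinner (A (\<xi> i)) (C y) = cinner (B (\<xi> i)) (D y)" if "i \<in> I" for i y
    using that by simp
  have "x \<in> {x. cinner (A x) (C y) = cinner (B x) (D y)}"
  proof (rule orthonormal_basis_total[OF \<xi>])
    show "closed {x. cinner (A x) (C y) = cinner (B x) (D y)}"
      by (intro closed_Collect_eq cont continuous_intros)
    show "csubspace {x. cinner (A x) (C y) = cinner (B x) (D y)}"
      by (auto simp: complex_vs.subspace_def lin' blinfun.add_right cinner_add_left
          cinner_scaleC_left)
  qed (use * in auto)
  then show ?thesis
    by simp
qed

lemma norm_orthogonal_sum:
  assumes "finite J" "\<And>i j. i \<in> J \<Longrightarrow> j \<in> J \<Longrightarrow> i \<noteq> j \<Longrightarrow> cinner (\<eta> i) (\<eta> j) = 0"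
  shows "(norm (\<Sum>i\<in>J. c i *\<^sub>C \<eta> i))\<^sup>2 = (\<Sum>i\<in>J. (cmod (c i))\<^sup>2 * (norm (\<eta> i))\<^sup>2)"
proof -
  have "complex_of_real ((norm (\<Sum>i\<in>J. c i *\<^sub>C \<eta> i))\<^sup>2)
      = (\<Sum>i\<in>J. \<Sum>j\<in>J. c i * (cnj (c j) * cinner (\<eta> i) (\<eta> j)))"
    by (simp only: cinner_self[symmetric] cinner_sum_left cinner_scaleC_left)
      (simp only: cinner_sum_right cinner_scaleC_right sum_distrib_left)
  also have "\<dots> = (\<Sum>i\<in>J. \<Sum>j\<in>J. if j = i then c i * (cnj (c i) * cinner (\<eta> i) (\<eta> i)) else 0)"
    by (intro sum.cong refl) (use assms(2) in auto)
  also have "\<dots> = (\<Sum>i\<in>J. c i * (cnj (c i) * cinner (\<eta> i) (\<eta> i)))"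
    using assms(1) by (simp add: sum.delta)
  also have "\<dots> = complex_of_real (\<Sum>i\<in>J. (cmod (c i))\<^sup>2 * (norm (\<eta> i))\<^sup>2)"
    by (simp only: cinner_self mult.assoc[symmetric] complex_norm_square[symmetric] of_real_mult
        of_real_sum)
  finally show ?thesis
    using of_real_eq_iff by blast
qed

lemma sum_scaleC_extend:
  assumes "finite K" "J \<subseteq> K"
  shows "(\<Sum>i\<in>J. c i *\<^sub>C \<eta> i) = (\<Sum>i\<in>K. (if i \<in> J then c i else 0) *\<^sub>C (\<eta> i :: 'a::chilbert_space))"
  using assms by (intro sum.mono_neutral_cong_left) auto

text \<open>
  The map \<open>\<xi> i \<mapsto> \<eta> i\<close> is contractive on the span of the basis by Pythagoras, so the closure of its
  graph is the graph of a contraction that is defined everywhere.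
\<close>

lemma basis_extension:
  fixes \<xi> :: "'i \<Rightarrow> 'k::chilbert_space" and \<eta> :: "'i \<Rightarrow> 'h::chilbert_space"
  assumes \<xi>: "orthonormal_basis \<xi> I"
    and orth: "\<And>i j. i \<in> I \<Longrightarrow> j \<in> I \<Longrightarrow> i \<noteq> j \<Longrightarrow> cinner (\<eta> i) (\<eta> j) = 0"
    and le1: "\<And>i. i \<in> I \<Longrightarrow> norm (\<eta> i) \<le> 1"
  obtains U :: "'k \<Rightarrow>\<^sub>L 'h" where "complex_linear U" "\<And>i. i \<in> I \<Longrightarrow> U (\<xi> i) = \<eta> i"
proof -
  define \<Gamma> where "\<Gamma> = {(\<Sum>i\<in>J. c i *\<^sub>C \<xi> i, \<Sum>i\<in>J. c i *\<^sub>C \<eta> i) |J c. finite J \<and> J \<subseteq> I}"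
  have elem: "p \<in> \<Gamma> \<longleftrightarrow> (\<exists>J c. p = (\<Sum>i\<in>J. c i *\<^sub>C \<xi> i, \<Sum>i\<in>J. c i *\<^sub>C \<eta> i) \<and>
      finite J \<and> J \<subseteq> I)" for p
    by (simp only: \<Gamma>_def mem_Collect_eq)
  have zero: "0 \<in> \<Gamma>"
    unfolding elem by (rule exI[of _ "{}"]) (simp add: zero_prod_def)
  have scale: "(c *\<^sub>C fst p, c *\<^sub>C snd p) \<in> \<Gamma>" if pG: "p \<in> \<Gamma>" for c p
  proof -
    obtain J d where "finite J" "J \<subseteq> I"
      and "p = (\<Sum>i\<in>J. d i *\<^sub>C \<xi> i, \<Sum>i\<in>J. d i *\<^sub>C \<eta> i)"
      using pG unfolding elem by blast
    moreover from this have "(c *\<^sub>C fst p, c *\<^sub>C snd p)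
        = (\<Sum>i\<in>J. (c * d i) *\<^sub>C \<xi> i, \<Sum>i\<in>J. (c * d i) *\<^sub>C \<eta> i)"
      by (simp add: complex_vs.scale_sum_right)
    ultimately show ?thesis
      unfolding elem by (intro exI[of _ J] exI[of _ "\<lambda>i. c * d i"] conjI)
  qed
  have add: "p + q \<in> \<Gamma>" if pq: "p \<in> \<Gamma>" "q \<in> \<Gamma>" for p q
  proof -
    obtain J d where J: "finite J" "J \<subseteq> I"
      and p: "p = (\<Sum>i\<in>J. d i *\<^sub>C \<xi> i, \<Sum>i\<in>J. d i *\<^sub>C \<eta> i)"
      using pq unfolding elem by blast
    obtain K c where K: "finite K" "K \<subseteq> I"
      and q: "q = (\<Sum>i\<in>K. c i *\<^sub>C \<xi> i, \<Sum>i\<in>K. c i *\<^sub>C \<eta> i)"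
      using pq unfolding elem by blast
    have fin: "finite (J \<union> K)"
      using J K by simp
    define e where "e i = (if i \<in> J then d i else 0) + (if i \<in> K then c i else 0)" for i
    have "p + q = (\<Sum>i\<in>J \<union> K. e i *\<^sub>C \<xi> i, \<Sum>i\<in>J \<union> K. e i *\<^sub>C \<eta> i)"
      unfolding p q sum_scaleC_extend[OF fin Un_upper1] sum_scaleC_extend[OF fin Un_upper2]
      by (simp only: e_def scaleC_add_left sum.distrib add_Pair)
    then show ?thesis
      unfolding elem using fin J K by (intro exI[of _ "J \<union> K"] exI[of _ e] conjI Un_least)
  qed
  have neg: "- p \<in> \<Gamma>" if "p \<in> \<Gamma>" for p
    using scale[OF that, of "- 1"] by (simp add: uminus_prod_def scaleC_one)
  have diff: "p - q \<in> \<Gamma>" if "p \<in> \<Gamma>" "q \<in> \<Gamma>" for p q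
    using add[OF that(1) neg[OF that(2)]] by simp
  have le: "norm y \<le> norm x" if xyG: "(x, y) \<in> \<Gamma>" for x y
  proof -
    obtain J c where J: "finite J" "J \<subseteq> I"
      and xy: "x = (\<Sum>i\<in>J. c i *\<^sub>C \<xi> i)" "y = (\<Sum>i\<in>J. c i *\<^sub>C \<eta> i)"
      using xyG unfolding elem by auto
    have ONE: "cinner (\<xi> i) (\<xi> j) = (if i = j then 1 else 0)" if "i \<in> J" "j \<in> J" for i j
      using \<xi> subsetD[OF J(2)] that by (auto simp: orthonormal_basis_def)
    have n1: "(norm (\<xi> i))\<^sup>2 = 1" if "i \<in> J" for i
      using ONE[OF that that] by (metis cinner_self of_real_eq_1_iff)
    have "(norm y)\<^sup>2 = (\<Sum>i\<in>J. (cmod (c i))\<^sup>2 * (norm (\<eta> i))\<^sup>2)"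
      unfolding xy using J orth by (intro norm_orthogonal_sum) blast+
    also have "\<dots> \<le> (\<Sum>i\<in>J. (cmod (c i))\<^sup>2 * 1)"
      using J le1 by (intro sum_mono mult_left_mono) (auto simp: power_le_one_iff)
    also have "\<dots> = (\<Sum>i\<in>J. (cmod (c i))\<^sup>2 * (norm (\<xi> i))\<^sup>2)"
      using n1 by simp
    also have "\<dots> = (norm x)\<^sup>2"
      unfolding xy using J ONE by (intro norm_orthogonal_sum[symmetric]) auto
    finally show ?thesis
      by (simp add: power2_le_iff_abs_le)
  qed
  have "csubspace (fst ` \<Gamma>)"
    unfolding complex_vs.subspace_def
  proof (intro conjI allI impI ballI)
    show "0 \<in> fst ` \<Gamma>"
      using imageI[OF zero, of fst] by simp
    show "c *\<^sub>C p \<in> fst ` \<Gamma>" if "p \<in> fst ` \<Gamma>" for c p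
    proof -
      from that obtain q where "q \<in> \<Gamma>" "p = fst q"
        by blast
      then show ?thesis
        using imageI[OF scale, of q fst c] by simp
    qed
    show "p + q \<in> fst ` \<Gamma>" if "p \<in> fst ` \<Gamma>" "q \<in> fst ` \<Gamma>" for p q
    proof -
      from that obtain p' q' where "p' \<in> \<Gamma>" "q' \<in> \<Gamma>" "p = fst p'" "q = fst q'"
        by blast
      with add[of p' q'] show ?thesis
        by (metis fst_add imageI)
    qed
  qed
  then have sub: "csubspace (closure (fst ` \<Gamma>))"
    by (rule csubspace_closure)
  have basis: "(\<xi> i, \<eta> i) \<in> \<Gamma>" if "i \<in> I" for i
    unfolding elem using that by (intro exI[of _ "{i}"] exI[of _ "\<lambda>_. 1"]) (simp add: scaleC_one)
  have "\<xi> i \<in> closure (fst ` \<Gamma>)" if "i \<in> I" for i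
    using imageI[OF basis[OF that], of fst] closure_subset[of "fst ` \<Gamma>"] by auto
  then have total: "x \<in> closure (fst ` \<Gamma>)" for x
    by (rule orthonormal_basis_total[OF \<xi> closed_closure sub])
  have "\<exists>y. (x, y) \<in> closure \<Gamma>" for x
    using contraction_graph_closure(2)[of \<Gamma>, OF diff le total] by blast
  then obtain u where u: "\<And>x. (x, u x) \<in> closure \<Gamma>"
    by metis
  have cadd: "p + q \<in> closure \<Gamma>" if "p \<in> closure \<Gamma>" "q \<in> closure \<Gamma>" for p q
    by (rule closure_closed_under[OF that _ add])
      (auto simp: case_prod_beta intro!: continuous_intros)
  have cscale: "(c *\<^sub>C fst p, c *\<^sub>C snd p) \<in> closure \<Gamma>" if "p \<in> closure \<Gamma>" for c p
    by (rule closure_mono_map[OF that])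
      (intro continuous_intros bounded_linear.continuous_on[OF bounded_linear_scaleC],
        rule subsetD[OF closure_subset scale])
  have cle: "norm y \<le> norm x" if "(x, y) \<in> closure \<Gamma>" for x y
    using contraction_graph_closure(1)[of \<Gamma>, OF diff le that] by blast
  have uniq: "y = u x" if "(x, y) \<in> closure \<Gamma>" for x y
    using cadd[OF that cscale[OF u[of x], of "- 1"]] cle[of 0 "y - u x"] by (simp add: scaleC_one)
  have uadd: "u (x + y) = u x + u y" for x y
    using uniq[of "x + y"] cadd[OF u u, of x y] by simp
  have uscale: "u (c *\<^sub>C x) = c *\<^sub>C u x" for c x
    using uniq[of "c *\<^sub>C x"] cscale[OF u, of c x] by simp
  have bl: "bounded_linear u"
    by (rule bounded_linear_intro[where K = 1])
      (use uadd uscale cle u in \<open>auto simp: scaleR_eq_scaleC\<close>)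
  show ?thesis
  proof
    show "complex_linear (Blinfun u)"
      by (simp add: complex_linear_def bounded_linear_Blinfun_apply[OF bl] uscale)
    show "Blinfun u (\<xi> i) = \<eta> i" if "i \<in> I" for i
      using uniq[of "\<xi> i" "\<eta> i"] basis[OF that] closure_subset[of \<Gamma>]
      by (auto simp: bounded_linear_Blinfun_apply[OF bl])
  qed
qed

definition orthonormal_set :: "'a::chilbert_space set \<Rightarrow> bool" where
  "orthonormal_set B \<longleftrightarrow> (\<forall>a\<in>B. \<forall>b\<in>B. cinner a b = (if a = b then 1 else 0))"

text \<open>
  Both sides are linear in \<open>x\<close>, so it is enough to compare them for \<open>x \<in> B\<close>.
\<close>

lemma orthonormal_expansion:
  assumes B: "finite B" "orthonormal_set B" and x: "x \<in> cspan B"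
  shows "(\<Sum>b\<in>B. cinner x b * cinner b y) = cinner x y"
proof (rule complex_vs.span_induct[OF x])
  show "csubspace {x. (\<Sum>b\<in>B. cinner x b * cinner b y) = cinner x y}"
    by (auto simp: complex_vs.subspace_def cinner_add_left cinner_scaleC_left distrib_right
        sum.distrib mult.assoc sum_distrib_left[symmetric])
  show "(\<Sum>b\<in>B. cinner a b * cinner b y) = cinner a y" if "a \<in> B" for a
  proof -
    have "(\<Sum>b\<in>B. cinner a b * cinner b y) = (\<Sum>b\<in>B. if b = a then cinner a y else 0)"
      by (intro sum.cong refl) (use B that in \<open>auto simp: orthonormal_set_def\<close>)
    then show ?thesis
      using B that by simp
  qed
qed

text \<open>Gram--Schmidt orthogonalization.\<close>

lemma finite_orthonormal_set_spanning:
  assumes "finite K"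
  obtains B where "finite B" "orthonormal_set B" "K \<subseteq> cspan (B :: 'a::chilbert_space set)"
proof -
  have "\<exists>B. finite B \<and> orthonormal_set B \<and> K \<subseteq> cspan (B :: 'a set)"
    using assms
  proof (induction K)
    case empty
    show ?case
      by (rule exI[of _ "{}"]) (simp add: orthonormal_set_def)
  next
    case (insert v K)
    then obtain B where B: "finite B" "orthonormal_set B" "K \<subseteq> cspan B"
      by blast
    \<comment> \<open>The component of \<open>v\<close> in the span of \<open>B\<close>; only \<open>w\<close> can contribute a new direction.\<close>
    define p where "p = (\<Sum>b\<in>B. cinner v b *\<^sub>C b)"
    define w where "w = v - p"
    have p: "p \<in> cspan B"
      unfolding p_def by (intro complex_vs.span_sum complex_vs.span_scale complex_vs.span_base)
    have orth: "cinner w b = 0" if "b \<in> B" for b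
    proof -
      have "cinner p b = (\<Sum>a\<in>B. if a = b then cinner v b else 0)"
        unfolding p_def cinner_sum_left
        by (intro sum.cong refl)
          (use B that in \<open>auto simp: orthonormal_set_def cinner_scaleC_left\<close>)
      then show ?thesis
        using B that by (simp add: w_def cinner_diff_left)
    qed
    show ?case
    proof (cases "w = 0")
      case True
      then show ?thesis
        using B p by (auto simp: w_def)
    next
      case False
      define u where "u = (1 / norm w) *\<^sub>R w"
      have wu: "w = complex_of_real (norm w) *\<^sub>C u"
        using False by (simp add: u_def scaleC_complex_of_real)
      have u1: "cinner u u = 1"
        using False by (simp add: u_def cinner_self)
      have u0: "cinner u b = 0" "cinner b u = 0" if "b \<in> B" for b
        using orth[OF that] cinner_commute[of b w]
        by (simp_all add: u_def cinner_scaleR_left cinner_scaleR_right)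
      have "v \<in> cspan (insert u B)"
      proof -
        have "v = p + complex_of_real (norm w) *\<^sub>C u"
          by (subst wu[symmetric]) (simp add: w_def)
        moreover have "p \<in> cspan (insert u B)"
          using p complex_vs.span_mono[of B "insert u B"] by blast
        ultimately show ?thesis
          by (auto intro!: complex_vs.span_add complex_vs.span_scale intro: complex_vs.span_base)
      qed
      moreover have "K \<subseteq> cspan (insert u B)"
        using B(3) complex_vs.span_mono[of B "insert u B"] by blast
      moreover have "orthonormal_set (insert u B)"
        using B(2) u0 u1 by (auto simp: orthonormal_set_def)
      ultimately show ?thesis
        using B(1) by (intro exI[of _ "insert u B"]) auto
    qed
  qed
  then show ?thesis
    using that by blast
qed


section \<open>Toeplitz families\<close>

text \<open>
  The relations without \<open>\<Sum> S\<^sub>e S\<^sub>e\<^sup>* \<le> P\<^sub>x\<close>. They suffice to make every finite sum of range projections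
  a projection, which is what gives a meaning to the infinite sum in the remaining relation.
\<close>

locale partial_isometry_family = wf_digraph G for G :: "('v, 'e) pre_digraph" +
  fixes S :: "'e \<Rightarrow> 'a::chilbert_space op" and P :: "'v \<Rightarrow> 'a op"
  assumes S_bops: "e \<in> arcs G \<Longrightarrow> S e \<in> bops"
    and P_projection: "x \<in> verts G \<Longrightarrow> projection (P x)"
    and P_orth: "x \<in> verts G \<Longrightarrow> y \<in> verts G \<Longrightarrow> x \<noteq> y \<Longrightarrow> P x o\<^sub>L P y = 0"
    and S_orth: "e \<in> arcs G \<Longrightarrow> f \<in> arcs G \<Longrightarrow> e \<noteq> f \<Longrightarrow> adj (S e) o\<^sub>L S f = 0"
    and S_initial: "e \<in> arcs G \<Longrightarrow> adj (S e) o\<^sub>L S e = P (tail G e)"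
begin

lemma P_bops: "x \<in> verts G \<Longrightarrow> P x \<in> bops"
  by (simp add: P_projection projectionD)

lemma P_P:
  assumes "x \<in> verts G" "y \<in> verts G"
  shows "P x (P y v) = (if x = y then P x v else 0)"
proof (cases "x = y")
  case True
  then show ?thesis
    using P_projection[OF assms(1)] by (simp add: projectionD)
next
  case False
  have "P x (P y v) = (P x o\<^sub>L P y) v"
    by simp
  then show ?thesis
    using False P_orth[OF assms False] by simp
qed

lemma adj_S_S:
  assumes "e \<in> arcs G" "f \<in> arcs G"
  shows "adj (S e) (S f v) = (if e = f then P (tail G e) v else 0)"
proof -
  have *: "adj (S e) (S f v) = (adj (S e) o\<^sub>L S f) v"
    by simp
  show ?thesis
    unfolding * using S_orth[OF assms] S_initial[OF assms(1)]
    by (auto simp del: blinfun_apply_blinfun_compose)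
qed

lemma S_P:
  assumes "x \<in> verts G" "e \<in> arcs G"
  shows "S e (P x v) = (if x = tail G e then S e v else 0)"
proof -
  have tail: "tail G e \<in> verts G"
    using assms(2) by simp
  have zero: "S e w = 0" if "P (tail G e) w = 0" for w
  proof -
    have "cinner (S e w) (S e w) = cinner (adj (S e) (S e w)) w"
      by (simp add: cinner_adj_left S_bops assms)
    then show ?thesis
      by (simp add: adj_S_S assms that cinner_self)
  qed
  show ?thesis
  proof (cases "x = tail G e")
    case True
    then show ?thesis
      using zero[of "v - P x v"] P_P[OF tail tail] by (simp add: blinfun.diff_right)
  next
    case False
    then show ?thesis
      using zero[of "P x v"] P_P[OF tail assms(1)] by auto
  qed
qed

lemma P_adj_S:
  assumes "x \<in> verts G" "e \<in> arcs G"
  shows "P x (adj (S e) v) = (if x = tail G e then adj (S e) v else 0)"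
proof (rule cinner_eqI)
  fix z
  have "cinner z (P x (adj (S e) v)) = cinner (S e (P x z)) v"
    by (simp add: cinner_adj_right S_bops assms projection_cinner(1)[OF P_projection, symmetric])
  then show "cinner z (P x (adj (S e) v)) = cinner z (if x = tail G e then adj (S e) v else 0)"
    by (simp add: S_P assms cinner_adj_right S_bops)
qed

definition edge_projection :: "'e set \<Rightarrow> 'a op" where
  "edge_projection F = (\<Sum>e\<in>F. S e o\<^sub>L adj (S e))"

lemma edge_projection_apply: "edge_projection F v = (\<Sum>e\<in>F. S e (adj (S e) v))"
  by (simp add: edge_projection_def blinfun.sum_left)

lemma cinner_edge_projection:
  assumes "F \<subseteq> arcs G"
  shows "cinner (edge_projection F v) w = (\<Sum>e\<in>F. cinner (adj (S e) v) (adj (S e) w))"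
  unfolding edge_projection_apply cinner_sum_left
  by (intro sum.cong refl) (use assms in \<open>auto simp: cinner_adj_right S_bops subset_iff\<close>)

lemma adj_S_edge_projection:
  assumes "finite F" "F \<subseteq> arcs G" "e \<in> arcs G"
  shows "adj (S e) (edge_projection F v) = (if e \<in> F then adj (S e) v else 0)"
proof -
  have "adj (S e) (edge_projection F v) = (\<Sum>f\<in>F. if f = e then adj (S e) v else 0)"
    unfolding edge_projection_apply blinfun.sum_right
    by (intro sum.cong refl) (use assms in \<open>auto simp: adj_S_S P_adj_S subset_iff\<close>)
  then show ?thesis
    using assms by simp
qed

lemma projection_edge_projection:
  assumes F: "finite F" "F \<subseteq> arcs G"
  shows "projection (edge_projection F)"
  unfolding projection_def
proof (intro conjI)
  show b: "edge_projection F \<in> bops"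
    unfolding edge_projection_def using F by (intro bops_sum bops_compose adj_bops S_bops) auto
  show "edge_projection F o\<^sub>L edge_projection F = edge_projection F"
    by (rule blinfun_eqI)
      (use F in \<open>auto simp: edge_projection_apply[of F "edge_projection F _"]
        adj_S_edge_projection subset_iff edge_projection_apply[symmetric] intro!: sum.cong\<close>)
  show "adj (edge_projection F) = edge_projection F"
  proof (rule adj_eqI[OF b])
    fix v w
    show "cinner (edge_projection F v) w = cinner v (edge_projection F w)"
      by (subst (2) cinner_commute) (simp add: cinner_edge_projection F cinner_commute[symmetric])
  qed
qed

text \<open>
  This is Bessel's inequality for the mutually orthogonal ranges of the \<open>S\<^sub>e\<close>.
\<close>

lemma adj_S_bessel:
  assumes "finite F" "F \<subseteq> arcs G"
  shows "(\<Sum>e\<in>F. (norm (adj (S e) v))\<^sup>2) \<le> (norm v)\<^sup>2"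
proof -
  note pr = projection_edge_projection[OF assms]
  have "complex_of_real (\<Sum>e\<in>F. (norm (adj (S e) v))\<^sup>2) = cinner (edge_projection F v) v"
    by (simp only: cinner_edge_projection[OF assms(2)] cinner_self of_real_sum)
  also have "\<dots> = complex_of_real ((norm (edge_projection F v))\<^sup>2)"
    by (simp only: projection_cinner(2)[OF pr, symmetric] cinner_self)
  finally have "(\<Sum>e\<in>F. (norm (adj (S e) v))\<^sup>2) = (norm (edge_projection F v))\<^sup>2"
    using of_real_eq_iff by blast
  then show ?thesis
    using projection_norm_le[OF pr, of v] by (simp add: power_mono)
qed

end


text \<open>
  The relation \<open>\<Sum> S\<^sub>e S\<^sub>e\<^sup>* \<le> P\<^sub>x\<close> enters algebraic computations only through its consequence
  \<open>P\<^bsub>r(e)\<^esub> S\<^sub>e = S\<^sub>e\<close>, which is a relation between single operators.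
\<close>

locale toeplitz_family = partial_isometry_family G S P
  for G :: "('v, 'e) pre_digraph"
    and S :: "'e \<Rightarrow> 'a::chilbert_space op" and P :: "'v \<Rightarrow> 'a op" +
  assumes S_final: "e \<in> arcs G \<Longrightarrow> P (head G e) o\<^sub>L S e = S e"
begin

lemma P_S:
  assumes "x \<in> verts G" "e \<in> arcs G"
  shows "P x (S e v) = (if x = head G e then S e v else 0)"
proof -
  have *: "P (head G e) (S e v) = S e v"
    using S_final[OF assms(2)] by (metis blinfun_apply_blinfun_compose)
  show ?thesis
    using P_P[OF assms(1) head_in_verts[OF assms(2)], of "S e v"] by (auto simp: *)
qed

lemma adj_S_P:
  assumes "x \<in> verts G" "e \<in> arcs G"
  shows "adj (S e) (P x v) = (if x = head G e then adj (S e) v else 0)"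
proof (rule cinner_eqI)
  fix z
  have "cinner z (adj (S e) (P x v)) = cinner (P x (S e z)) v"
    by (simp add: cinner_adj_right S_bops assms projection_cinner(1)[OF P_projection])
  then show "cinner z (adj (S e) (P x v)) = cinner z (if x = head G e then adj (S e) v else 0)"
    by (simp add: P_S assms cinner_adj_right S_bops)
qed

end


section \<open>Words in a Toeplitz family\<close>

text \<open>
  The operator \<open>S\<^bsub>e\<^sub>k\<^esub> \<cdots> S\<^bsub>e\<^sub>1\<^esub>\<close> of the list \<open>[e\<^sub>1, \<dots>, e\<^sub>k]\<close>; lists that are not paths are allowed, and
  give the zero operator in a Toeplitz family.
\<close>

primrec path_op :: "('e \<Rightarrow> 'a::chilbert_space op) \<Rightarrow> 'e list \<Rightarrow> 'a op" where
  "path_op S [] = id_blinfun"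
| "path_op S (e # p) = path_op S p o\<^sub>L S e"

lemma path_op_snoc: "path_op S (p @ [e]) = S e o\<^sub>L path_op S p"
  by (induction p) (auto intro!: blinfun_eqI)

text \<open>
  The normal form \<open>S\<^sub>p P\<^sub>x S\<^sub>q\<^sup>*\<close> of a product of generators and their adjoints.
\<close>

definition word_op ::
    "('e \<Rightarrow> 'a::chilbert_space op) \<Rightarrow> ('v \<Rightarrow> 'a op) \<Rightarrow> 'v \<Rightarrow> 'e list \<Rightarrow> 'e list \<Rightarrow> 'a op" where
  "word_op S P x p q = path_op S p o\<^sub>L P x o\<^sub>L adj (path_op S q)"

context toeplitz_family
begin

lemma path_op_bops: "set p \<subseteq> arcs G \<Longrightarrow> path_op S p \<in> bops"
  by (induction p) (auto intro: bops_compose S_bops id_bops)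

lemma adj_path_op_Cons:
  "e \<in> arcs G \<Longrightarrow> set q \<subseteq> arcs G \<Longrightarrow>
    adj (path_op S (e # q)) = adj (S e) o\<^sub>L adj (path_op S q)"
  by (simp add: adj_compose path_op_bops S_bops)

lemma adj_path_op_snoc:
  "e \<in> arcs G \<Longrightarrow> set q \<subseteq> arcs G \<Longrightarrow>
    adj (path_op S (q @ [e])) = adj (path_op S q) o\<^sub>L adj (S e)"
  by (simp add: path_op_snoc adj_compose path_op_bops S_bops)

lemma word_op_bops:
  "x \<in> verts G \<Longrightarrow> set p \<subseteq> arcs G \<Longrightarrow> set q \<subseteq> arcs G \<Longrightarrow> word_op S P x p q \<in> bops"
  unfolding word_op_def by (intro bops_compose path_op_bops adj_bops P_bops)

lemma adj_word_op:
  assumes "x \<in> verts G" "set p \<subseteq> arcs G" "set q \<subseteq> arcs G"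
  shows "adj (word_op S P x p q) = word_op S P x q p"
proof -
  have "adj (P x) = P x"
    using P_projection[OF assms(1)] by (rule projectionD)
  then show ?thesis
    using assms unfolding word_op_def
    by (simp add: adj_compose path_op_bops adj_bops P_bops bops_compose adj_adj
        blinfun_compose_assoc)
qed

text \<open>
  The rules that bring \<open>S\<^sub>e\<close> or \<open>S\<^sub>e\<^sup>*\<close> times a normal form into normal form. Which rule applies, and
  whether the result is zero, depends on the graph only, so the same rewriting is valid in every
  Toeplitz family.
\<close>

lemma S_word_op: "S e o\<^sub>L word_op S P x p q = word_op S P x (p @ [e]) q"
  by (auto simp: word_op_def path_op_snoc intro!: blinfun_eqI)

lemma adj_S_word_op_Nil:
  assumes "e \<in> arcs G" "x \<in> verts G" "set q \<subseteq> arcs G"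
  shows "adj (S e) o\<^sub>L word_op S P x [] q =
    (if x = head G e then word_op S P (tail G e) [] (e # q) else 0)"
  using assms
  by (auto simp: word_op_def adj_path_op_Cons adj_S_P P_adj_S simp del: path_op.simps(2)
      intro!: blinfun_eqI)

lemma adj_S_word_op_snoc_neq:
  assumes "e \<in> arcs G" "f \<in> arcs G" "e \<noteq> f"
  shows "adj (S e) o\<^sub>L word_op S P x (p @ [f]) q = 0"
  using assms by (auto simp: word_op_def path_op_snoc adj_S_S intro!: blinfun_eqI)

lemma adj_S_word_op_snoc:
  assumes "e \<in> arcs G" "x \<in> verts G" "set p \<subseteq> arcs G"
  shows "adj (S e) o\<^sub>L word_op S P x (p @ [e]) q =
    (if tail G e = (if p = [] then x else head G (last p)) then word_op S P x p q else 0)"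
proof -
  have *: "adj (S e) o\<^sub>L word_op S P x (p @ [e]) q = P (tail G e) o\<^sub>L word_op S P x p q"
    using assms by (auto simp: word_op_def path_op_snoc adj_S_S intro!: blinfun_eqI)
  show ?thesis
  proof (cases p rule: rev_cases)
    case Nil
    then show ?thesis
      unfolding * using assms by (auto simp: word_op_def P_P intro!: blinfun_eqI)
  next
    case (snoc p' f)
    then show ?thesis
      unfolding * using assms by (auto simp: word_op_def path_op_snoc P_S intro!: blinfun_eqI)
  qed
qed

end

text \<open>
  Formal linear combinations of normal forms, which can be evaluated in several Toeplitz families.
\<close>

type_synonym ('v, 'e) combination = "(complex \<times> 'v \<times> 'e list \<times> 'e list) list"

definition combination_op ::
    "('e \<Rightarrow> 'a::chilbert_space op) \<Rightarrow> ('v \<Rightarrow> 'a op) \<Rightarrow> ('v, 'e) combination \<Rightarrow> 'a op" where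
  "combination_op S P js = (\<Sum>(c, x, p, q)\<leftarrow>js. scale_op c (word_op S P x p q))"

definition combination_in :: "('v, 'e) pre_digraph \<Rightarrow> ('v, 'e) combination \<Rightarrow> bool" where
  "combination_in G js \<longleftrightarrow>
    (\<forall>(c, x, p, q)\<in>set js. x \<in> verts G \<and> set p \<subseteq> arcs G \<and> set q \<subseteq> arcs G)"

lemma combination_op_simps [simp]:
  "combination_op S P [] = 0"
  "combination_op S P ((c, x, p, q) # js) =
    scale_op c (word_op S P x p q) + combination_op S P js"
  by (simp_all add: combination_op_def)

lemma combination_op_append [simp]:
  "combination_op S P (js @ ks) = combination_op S P js + combination_op S P ks"
  by (simp add: combination_op_def)

lemma combination_in_simps [simp]:
  "combination_in G []"
  "combination_in G ((c, x, p, q) # js) \<longleftrightarrow>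
    x \<in> verts G \<and> set p \<subseteq> arcs G \<and> set q \<subseteq> arcs G \<and> combination_in G js"
  "combination_in G (js @ ks) \<longleftrightarrow> combination_in G js \<and> combination_in G ks"
  by (simp_all add: combination_in_def ball_Un)

lemma combination_op_scale:
  "scale_op c (combination_op S P js) =
    combination_op S P (map (\<lambda>(d, x, p, q). (c * d, x, p, q)) js)"
proof (induction js)
  case Nil
  show ?case
    by (auto intro!: blinfun_eqI)
next
  case (Cons j js)
  then show ?case
    by (cases j) (simp add: scale_op_add scale_op_scale_op)
qed

lemma combination_in_scale:
  "combination_in G js \<Longrightarrow> combination_in G (map (\<lambda>(d, x, p, q). (c * d, x, p, q)) js)"
  by (force simp: combination_in_def)

lemma (in toeplitz_family) combination_op_bops:
  "combination_in G js \<Longrightarrow> combination_op S P js \<in> bops"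
proof (induction js)
  case (Cons j js)
  then show ?case
    by (cases j) (auto intro!: bops_add bops_scale word_op_bops)
qed auto

lemma (in toeplitz_family) adj_combination_op:
  "combination_in G js \<Longrightarrow>
    adj (combination_op S P js) = combination_op S P (map (\<lambda>(c, x, p, q). (cnj c, x, q, p)) js)"
proof (induction js)
  case (Cons j js)
  then show ?case
    by (cases j)
      (auto simp: adj_add adj_scale adj_word_op word_op_bops combination_op_bops bops_scale)
qed auto

locale toeplitz_pair =
  L: toeplitz_family G L R + S: toeplitz_family G S P
  for G :: "('v, 'e) pre_digraph"
    and L :: "'e \<Rightarrow> 'k::chilbert_space op" and R :: "'v \<Rightarrow> 'k op"
    and S :: "'e \<Rightarrow> 'h::chilbert_space op" and P :: "'v \<Rightarrow> 'h op"
begin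

text \<open>
  The same formal expression may vanish in one family and not in the other as long as the norms
  have not been compared, so its two values are related by a set of pairs rather than by a map.
\<close>

definition word_graph :: "('k op \<times> 'h op) set" where
  "word_graph =
    {(combination_op L R js, combination_op S P js) |js. combination_in G js}"

lemma word_graphI:
  "combination_in G js \<Longrightarrow> (combination_op L R js, combination_op S P js) \<in> word_graph"
  unfolding word_graph_def by blast

lemma word_graphE:
  assumes "(T, T') \<in> word_graph"
  obtains js where "combination_in G js" "T = combination_op L R js" "T' = combination_op S P js"
  using assms unfolding word_graph_def by blast

lemma word_graph_zero: "(0, 0) \<in> word_graph"
  using word_graphI[of "[]"] by simp

lemma word_graph_add:
  assumes "(T, T') \<in> word_graph" "(U, U') \<in> word_graph"
  shows "(T + U, T' + U') \<in> word_graph"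
proof -
  obtain js ks where "combination_in G js" "combination_in G ks"
    "T = combination_op L R js" "T' = combination_op S P js"
    "U = combination_op L R ks" "U' = combination_op S P ks"
    using assms by (auto elim!: word_graphE)
  then show ?thesis
    using word_graphI[of "js @ ks"] by simp
qed

lemma word_graph_scale:
  assumes "(T, T') \<in> word_graph"
  shows "(scale_op c T, scale_op c T') \<in> word_graph"
proof -
  obtain js where js: "combination_in G js" "T = combination_op L R js" "T' = combination_op S P js"
    using assms by (rule word_graphE)
  show ?thesis
    unfolding js(2,3) combination_op_scale by (intro word_graphI combination_in_scale js(1))
qed

lemma word_graph_adj:
  assumes "(T, T') \<in> word_graph"
  shows "(adj T, adj T') \<in> word_graph"
proof -
  obtain js where js: "combination_in G js" "T = combination_op L R js" "T' = combination_op S P js"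
    using assms by (rule word_graphE)
  then have "combination_in G (map (\<lambda>(c, x, p, q). (cnj c, x, q, p)) js)"
    by (force simp: combination_in_def)
  then show ?thesis
    using js by (auto simp: L.adj_combination_op S.adj_combination_op intro: word_graphI)
qed

lemma word_graph_word:
  assumes "x \<in> verts G" "set p \<subseteq> arcs G" "set q \<subseteq> arcs G"
  shows "(word_op L R x p q, word_op S P x p q) \<in> word_graph"
  using word_graphI[of "[(1, x, p, q)]"] assms by (simp add: scale_op_one)

lemma word_graph_compose_left:
  assumes "(T, T') \<in> word_graph" and A: "A \<in> bops" "A' \<in> bops"
    and word: "\<And>x p q. x \<in> verts G \<Longrightarrow> set p \<subseteq> arcs G \<Longrightarrow> set q \<subseteq> arcs G \<Longrightarrow>
      (A o\<^sub>L word_op L R x p q, A' o\<^sub>L word_op S P x p q) \<in> word_graph"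
  shows "(A o\<^sub>L T, A' o\<^sub>L T') \<in> word_graph"
proof -
  obtain js where "combination_in G js" "T = combination_op L R js" "T' = combination_op S P js"
    using assms(1) by (rule word_graphE)
  then show ?thesis
  proof (induction js arbitrary: T T')
    case Nil
    then show ?case
      by (simp add: word_graph_zero)
  next
    case (Cons j js)
    then show ?case
      using A word
      by (cases j) (auto simp: blinfun_compose_add_right compose_scale
          intro!: word_graph_add word_graph_scale)
  qed
qed

lemma word_graph_S_compose:
  assumes "(T, T') \<in> word_graph" "e \<in> arcs G"
  shows "(L e o\<^sub>L T, S e o\<^sub>L T') \<in> word_graph"
  using assms(1)
  by (rule word_graph_compose_left)
    (use assms(2) in \<open>auto simp: L.S_bops S.S_bops L.S_word_op S.S_word_op intro!: word_graph_word\<close>)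

lemma word_graph_adj_S_compose:
  assumes "(T, T') \<in> word_graph" and e: "e \<in> arcs G"
  shows "(adj (L e) o\<^sub>L T, adj (S e) o\<^sub>L T') \<in> word_graph"
  using assms(1)
proof (rule word_graph_compose_left)
  fix x p q assume xpq: "x \<in> verts G" "set p \<subseteq> arcs G" "set q \<subseteq> arcs G"
  show "(adj (L e) o\<^sub>L word_op L R x p q, adj (S e) o\<^sub>L word_op S P x p q) \<in> word_graph"
  proof (cases p rule: rev_cases)
    case Nil
    then show ?thesis
      using xpq e by (auto simp: L.adj_S_word_op_Nil S.adj_S_word_op_Nil
          intro!: word_graph_word word_graph_zero)
  next
    case (snoc p' f)
    show ?thesis
    proof (cases "e = f")
      case True
      then show ?thesis
        using xpq e snoc by (auto simp: L.adj_S_word_op_snoc S.adj_S_word_op_snoc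
            intro!: word_graph_word word_graph_zero)
    next
      case False
      then show ?thesis
        using xpq e snoc by (auto simp: L.adj_S_word_op_snoc_neq S.adj_S_word_op_snoc_neq
            intro!: word_graph_zero)
    qed
  qed
qed (use e in \<open>auto intro: adj_bops L.S_bops S.S_bops\<close>)

text \<open>
  Multiplication by \<open>P\<^sub>x\<close> is reduced to the rules for \<open>S\<^sub>e\<close> and \<open>S\<^sub>e\<^sup>*\<close>: there is an edge \<open>e\<close> with source
  \<open>x\<close>, and \<open>P\<^sub>x = S\<^sub>e\<^sup>* S\<^sub>e\<close>.
\<close>

lemma word_graph_compose:
  assumes "no_sinks G" and T: "(T, T') \<in> word_graph" and U: "(U, U') \<in> word_graph"
  shows "(T o\<^sub>L U, T' o\<^sub>L U') \<in> word_graph"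
proof -
  have path: "(path_op L p o\<^sub>L V, path_op S p o\<^sub>L V') \<in> word_graph"
    if "set p \<subseteq> arcs G" "(V, V') \<in> word_graph" for p V V'
    using that by (induction p rule: rev_induct)
      (auto simp: path_op_snoc blinfun_compose_assoc intro: word_graph_S_compose)
  have path_adj: "(adj (path_op L q) o\<^sub>L V, adj (path_op S q) o\<^sub>L V') \<in> word_graph"
    if "set q \<subseteq> arcs G" "(V, V') \<in> word_graph" for q V V'
    using that by (induction q)
      (auto simp: L.adj_path_op_Cons S.adj_path_op_Cons adj_id blinfun_compose_assoc
        simp del: path_op.simps(2) intro: word_graph_adj_S_compose)
  have vertex: "(R x o\<^sub>L V, P x o\<^sub>L V') \<in> word_graph"
    if x: "x \<in> verts G" and V: "(V, V') \<in> word_graph" for x V V'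
  proof -
    obtain e where e: "e \<in> arcs G" "tail G e = x"
      using assms(1) x unfolding no_sinks_def by blast
    have "(adj (L e) o\<^sub>L (L e o\<^sub>L V), adj (S e) o\<^sub>L (S e o\<^sub>L V')) \<in> word_graph"
      using V e by (intro word_graph_adj_S_compose word_graph_S_compose)
    then show ?thesis
      using e L.S_initial[OF e(1)] S.S_initial[OF e(1)] by (simp add: blinfun_compose_assoc[symmetric])
  qed
  have word: "(word_op L R x p q o\<^sub>L U, word_op S P x p q o\<^sub>L U') \<in> word_graph"
    if "x \<in> verts G" "set p \<subseteq> arcs G" "set q \<subseteq> arcs G" for x p q
    using that U unfolding word_op_def blinfun_compose_assoc by (intro path vertex path_adj)
  obtain js where "combination_in G js" "T = combination_op L R js" "T' = combination_op S P js"
    using T by (rule word_graphE)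
  then show ?thesis
  proof (induction js arbitrary: T T')
    case Nil
    then show ?case
      by (simp add: word_graph_zero)
  next
    case (Cons j js)
    then show ?case
      using word
      by (cases j) (auto simp: blinfun_compose_add_left scale_compose
          intro!: word_graph_add word_graph_scale)
  qed
qed

end

context toeplitz_family
begin

lemma projection_vertex_sum:
  assumes V: "finite V" "V \<subseteq> verts G"
  shows "projection (\<Sum>x\<in>V. P x)"
  unfolding projection_def
proof (intro conjI)
  show b: "(\<Sum>x\<in>V. P x) \<in> bops"
    using V by (intro bops_sum P_bops) auto
  have "P x (\<Sum>y\<in>V. P y v) = P x v" if "x \<in> V" for x v
  proof -
    have "P x (\<Sum>y\<in>V. P y v) = (\<Sum>y\<in>V. if y = x then P x v else 0)"
      unfolding blinfun.sum_right by (intro sum.cong refl) (use V that in \<open>auto simp: P_P subset_iff\<close>)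
    then show ?thesis
      using V that by simp
  qed
  then show "(\<Sum>x\<in>V. P x) o\<^sub>L (\<Sum>x\<in>V. P x) = (\<Sum>x\<in>V. P x)"
    by (intro blinfun_eqI) (simp add: blinfun.sum_left)
  show "adj (\<Sum>x\<in>V. P x) = (\<Sum>x\<in>V. P x)"
    by (rule adj_eqI[OF b])
      (use V in \<open>auto simp: blinfun.sum_left cinner_sum_left cinner_sum_right
        projection_cinner(1)[OF P_projection] subset_iff intro!: sum.cong\<close>)
qed

lemma norm_adj_S_le: "e \<in> arcs G \<Longrightarrow> norm (adj (S e) v) \<le> norm v"
  using adj_S_bessel[of "{e}" v] by simp

lemma norm_adj_path_op_le: "set q \<subseteq> arcs G \<Longrightarrow> norm (adj (path_op S q) v) \<le> norm v"
proof (induction q)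
  case (Cons e q)
  then have "norm (adj (S e) (adj (path_op S q) v)) \<le> norm (adj (path_op S q) v)"
    by (intro norm_adj_S_le) simp
  with Cons show ?case
    by (simp add: adj_path_op_Cons del: path_op.simps(2))
qed (simp add: adj_id)

lemma norm_P_le: "x \<in> verts G \<Longrightarrow> norm (P x v) \<le> norm v"
  by (rule projection_norm_le[OF P_projection])

lemma cinner_path_op: "set q \<subseteq> arcs G \<Longrightarrow>
    cinner (path_op S q v) w = cinner v (adj (path_op S q) w)"
  by (simp add: cinner_adj_right path_op_bops)

end

text \<open>
  A unit vector \<open>\<omega>\<^sub>x\<close> in the range of each \<open>P\<^sub>x\<close> that is annihilated by all \<open>S\<^sub>e\<^sup>*\<close>. Such vectors are
  the basis vectors of the trivial paths in the left regular representation, and the wandering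
  vectors of a family whose range projections do not add up to \<open>P\<^sub>x\<close>.
\<close>

locale toeplitz_vacuum = toeplitz_family G S P
  for G :: "('v, 'e) pre_digraph"
    and S :: "'e \<Rightarrow> 'a::chilbert_space op" and P :: "'v \<Rightarrow> 'a op" +
  fixes \<omega> :: "'v \<Rightarrow> 'a"
  assumes norm_vacuum: "x \<in> verts G \<Longrightarrow> norm (\<omega> x) = 1"
    and P_vacuum: "x \<in> verts G \<Longrightarrow> P x (\<omega> x) = \<omega> x"
    and adj_S_vacuum: "x \<in> verts G \<Longrightarrow> e \<in> arcs G \<Longrightarrow> adj (S e) (\<omega> x) = 0"
begin

lemma cinner_vacuum:
  "x \<in> verts G \<Longrightarrow> y \<in> verts G \<Longrightarrow> cinner (\<omega> x) (\<omega> y) = (if x = y then 1 else 0)"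
proof -
  assume xy: "x \<in> verts G" "y \<in> verts G"
  have "cinner (\<omega> x) (\<omega> y) = cinner (P x (\<omega> x)) (P y (\<omega> y))"
    using xy by (simp add: P_vacuum)
  also have "\<dots> = cinner (\<omega> x) (P x (P y (\<omega> y)))"
    using xy by (simp add: projection_cinner(1)[OF P_projection])
  finally show ?thesis
    using xy P_P[OF xy, of "\<omega> y"] by (auto simp: P_vacuum cinner_self norm_vacuum)
qed

end


section \<open>The Poisson kernel\<close>

locale toeplitz_vacuum_pair = toeplitz_pair G L R S P + L: toeplitz_vacuum G L R \<omega>
  for G :: "('v, 'e) pre_digraph"
    and L :: "'e \<Rightarrow> 'k::chilbert_space op" and R :: "'v \<Rightarrow> 'k op"
    and S :: "'e \<Rightarrow> 'h::chilbert_space op" and P :: "'v \<Rightarrow> 'h op"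
    and \<omega> :: "'v \<Rightarrow> 'k"

text \<open>
  The kernel is built from the edges in the finite set \<open>F\<close> only; \<open>V\<close> contains their end points.
\<close>

locale poisson_kernel = toeplitz_vacuum_pair G L R S P \<omega>
  for G :: "('v, 'e) pre_digraph"
    and L :: "'e \<Rightarrow> 'k::chilbert_space op" and R :: "'v \<Rightarrow> 'k op"
    and S :: "'e \<Rightarrow> 'h::chilbert_space op" and P :: "'v \<Rightarrow> 'h op"
    and \<omega> :: "'v \<Rightarrow> 'k" +
  fixes F :: "'e set" and V :: "'v set" and r :: real
  assumes finite_F: "finite F" and F_arcs: "F \<subseteq> arcs G"
    and finite_V: "finite V" and V_verts: "V \<subseteq> verts G"
    and tail_V: "e \<in> F \<Longrightarrow> tail G e \<in> V" and head_V: "e \<in> F \<Longrightarrow> head G e \<in> V"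
    and r_nonneg: "0 \<le> r" and r_less: "r < 1"
begin

lemma F_arc: "e \<in> F \<Longrightarrow> e \<in> arcs G"
  using F_arcs by blast

lemma V_vert: "x \<in> V \<Longrightarrow> x \<in> verts G"
  using V_verts by blast

text \<open>
  The operator \<open>\<Delta>\<close>. For a projection \<open>Q\<close> the square root of \<open>1 - r\<^sup>2 Q\<close> is
  \<open>1 - (1 - sqrt (1 - r\<^sup>2)) Q\<close>.
\<close>

definition defect :: "'h \<Rightarrow> 'h" where
  "defect v = v - (1 - sqrt (1 - r\<^sup>2)) *\<^sub>R S.edge_projection F v"

lemma cinner_defect:
  "cinner (defect v) (defect w) = cinner v w - of_real (r\<^sup>2) * cinner (S.edge_projection F v) w"
proof -
  define Q where "Q = blinfun_apply (S.edge_projection F)"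
  define c where "c = 1 - sqrt (1 - r\<^sup>2)"
  note pr = S.projection_edge_projection[OF finite_F F_arcs]
  have "(sqrt (1 - r\<^sup>2))\<^sup>2 = 1 - r\<^sup>2"
    using r_nonneg r_less by (simp add: abs_square_le_1)
  then have c: "2 * c - c\<^sup>2 = r\<^sup>2"
    by (simp add: c_def power2_eq_square algebra_simps)
  have Q: "cinner v (Q w) = cinner (Q v) w" "cinner (Q v) (Q w) = cinner (Q v) w"
    by (simp only: Q_def projection_cinner(1)[OF pr])
      (simp only: Q_def projection_cinner(2)[OF pr])
  have "cinner (defect v) (defect w) = cinner (v - c *\<^sub>R Q v) (w - c *\<^sub>R Q w)"
    by (simp only: defect_def Q_def c_def)
  also have "\<dots> = cinner v w - of_real c * cinner v (Q w)
      - (of_real c * cinner (Q v) w - of_real c * (of_real c * cinner (Q v) (Q w)))"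
    by (simp only: cinner_diff_left cinner_diff_right cinner_scaleR_left cinner_scaleR_right)
      (simp only: algebra_simps)
  also have "\<dots> = cinner v w - of_real (2 * c - c\<^sup>2) * cinner (Q v) w"
    unfolding Q by (simp add: algebra_simps power2_eq_square)
  finally show ?thesis
    by (simp only: c Q_def)
qed

text \<open>
  The coordinate along \<open>b\<close> of the truncated Poisson kernel, i.e. the vector
  \<open>\<Sum> r\<^bsup>|w|\<^esup> \<langle>\<Delta> S\<^sub>w\<^sup>* h, b\<rangle> \<xi>\<^sub>w\<close> over the paths \<open>w\<close> of length less than \<open>n\<close> with edges in \<open>F\<close> and
  source in \<open>V\<close>. The recursion sorts them by their last edge, as \<open>L\<^sub>e \<xi>\<^sub>w = \<xi>\<^bsub>e w\<^esub>\<close> and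
  \<open>S\<^bsub>e w\<^esub>\<^sup>* = S\<^sub>w\<^sup>* S\<^sub>e\<^sup>*\<close>.
\<close>

primrec kernel :: "nat \<Rightarrow> 'h \<Rightarrow> 'h \<Rightarrow> 'k" where
  "kernel 0 b h = 0"
| "kernel (Suc n) b h =
    (\<Sum>x\<in>V. cinner (defect (P x h)) b *\<^sub>C \<omega> x) + r *\<^sub>R (\<Sum>e\<in>F. L e (kernel n b (adj (S e) h)))"

lemma kernel_zero [simp]: "kernel n b 0 = 0"
  by (induction n) (auto simp: defect_def)

lemma R_kernel:
  assumes "x \<in> V"
  shows "R x (kernel n b h) = kernel n b (P x h)"
proof (cases n)
  case (Suc m)
  have "R x (\<Sum>y\<in>V. cinner (defect (P y h)) b *\<^sub>C \<omega> y)
      = (\<Sum>y\<in>V. cinner (defect (P y (P x h))) b *\<^sub>C \<omega> y)"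
    unfolding blinfun.sum_right
  proof (intro sum.cong refl)
    fix y assume y: "y \<in> V"
    have "R x (\<omega> y) = (if x = y then \<omega> y else 0)"
      using L.P_P[of x y "\<omega> y"] V_vert[OF y] V_vert[OF assms]
      by (cases "x = y") (auto simp: L.P_vacuum)
    then show "R x (cinner (defect (P y h)) b *\<^sub>C \<omega> y)
        = cinner (defect (P y (P x h))) b *\<^sub>C \<omega> y"
      using V_vert[OF y] V_vert[OF assms]
      by (auto simp: bopsD[OF L.P_bops] S.P_P defect_def)
  qed
  moreover have "R x (\<Sum>e\<in>F. L e (kernel m b (adj (S e) h)))
      = (\<Sum>e\<in>F. L e (kernel m b (adj (S e) (P x h))))"
    unfolding blinfun.sum_right
    using F_arc V_vert[OF assms] by (intro sum.cong refl) (auto simp: L.P_S S.adj_S_P)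
  ultimately show ?thesis
    unfolding Suc by (simp add: blinfun.add_right blinfun.scaleR_right)
qed simp

text \<open>
  \<open>L\<^sub>e\<^sup>*\<close> removes the last edge of a path, and the kernel gives the paths ending in \<open>e\<close> the weights
  of \<open>r S\<^sub>e\<^sup>* h\<close>.
\<close>

lemma adj_L_kernel:
  assumes "e \<in> F"
  shows "adj (L e) (kernel n b h) = r *\<^sub>R kernel (n - 1) b (adj (S e) h)"
proof (cases n)
  case (Suc m)
  have e: "e \<in> arcs G"
    using assms by (rule F_arc)
  have vac: "adj (L e) (\<Sum>y\<in>V. cinner (defect (P y h)) b *\<^sub>C \<omega> y) = 0"
    unfolding blinfun.sum_right
    by (intro sum.neutral ballI)
      (use e V_vert in \<open>auto simp: bopsD[OF adj_bops[OF L.S_bops]] L.adj_S_vacuum\<close>)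
  have "adj (L e) (\<Sum>f\<in>F. L f (kernel m b (adj (S f) h)))
      = (\<Sum>f\<in>F. if f = e then R (tail G e) (kernel m b (adj (S e) h)) else 0)"
    unfolding blinfun.sum_right
    by (intro sum.cong refl) (use e F_arc in \<open>auto simp: L.adj_S_S\<close>)
  also have "\<dots> = kernel m b (adj (S e) h)"
    using assms finite_F e by (simp add: R_kernel tail_V S.P_adj_S)
  finally show ?thesis
    unfolding Suc using vac by (simp add: blinfun.add_right blinfun.scaleR_right)
qed simp

lemma adj_path_kernel:
  "set q \<subseteq> F \<Longrightarrow> adj (path_op L q) (kernel n b h) =
    (r ^ length q) *\<^sub>R kernel (n - length q) b (adj (path_op S q) h)"
proof (induction q)
  case Nil
  then show ?case
    by (simp add: adj_id)
next
  case (Cons e q)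
  then have "e \<in> arcs G" "set q \<subseteq> arcs G"
    using F_arcs by auto
  with Cons show ?case
    by (simp add: L.adj_path_op_Cons S.adj_path_op_Cons blinfun.scaleR_right adj_L_kernel
        mult.commute del: path_op.simps(2))
qed

definition vertex_form :: "'h \<Rightarrow> 'h \<Rightarrow> complex" where
  "vertex_form h g = (\<Sum>x\<in>V. cinner (P x h) g)"

text \<open>
  The sum of \<open>\<langle>S\<^sub>w\<^sup>* h, S\<^sub>w\<^sup>* g\<rangle>\<close> over the paths \<open>w\<close> of length \<open>k\<close> in \<open>F\<close>, which measures the error of
  truncation.
\<close>

primrec remainder :: "nat \<Rightarrow> 'h \<Rightarrow> 'h \<Rightarrow> complex" where
  "remainder 0 h g = vertex_form h g"
| "remainder (Suc k) h g = (\<Sum>e\<in>F. remainder k (adj (S e) h) (adj (S e) g))"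

lemma vertex_form_P: "x \<in> V \<Longrightarrow> vertex_form (P x h) g = cinner (P x h) g"
proof -
  assume x: "x \<in> V"
  have "vertex_form (P x h) g = (\<Sum>y\<in>V. if y = x then cinner (P x h) g else 0)"
    unfolding vertex_form_def
    by (intro sum.cong refl) (use x V_vert in \<open>auto simp: S.P_P\<close>)
  then show ?thesis
    using x finite_V by simp
qed

lemma vertex_form_adj_S: "e \<in> F \<Longrightarrow> vertex_form (adj (S e) h) g = cinner (adj (S e) h) g"
  using vertex_form_P[OF tail_V, of e "adj (S e) h" g] F_arc[of e] by (simp add: S.P_adj_S)

text \<open>
  The left-hand side is the contribution of the trivial paths to \<open>\<langle>K h, K g\<rangle>\<close>; the subtracted sum
  cancels against the paths of length one.
\<close>

lemma sum_cinner_defect: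
  "(\<Sum>x\<in>V. cinner (defect (P x h)) (defect (P x g))) =
    vertex_form h g - of_real (r\<^sup>2) * (\<Sum>e\<in>F. cinner (adj (S e) h) (adj (S e) g))"
proof -
  have "(\<Sum>x\<in>V. cinner (S.edge_projection F (P x h)) (P x g))
      = (\<Sum>x\<in>V. \<Sum>e\<in>F. if x = head G e then cinner (adj (S e) h) (adj (S e) g) else 0)"
    unfolding S.cinner_edge_projection[OF F_arcs]
    by (intro sum.cong refl) (use V_vert F_arc in \<open>auto simp: S.adj_S_P\<close>)
  also have "\<dots> = (\<Sum>e\<in>F. \<Sum>x\<in>V. if x = head G e then cinner (adj (S e) h) (adj (S e) g) else 0)"
    by (rule sum.swap)
  also have "\<dots> = (\<Sum>e\<in>F. cinner (adj (S e) h) (adj (S e) g))"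
    using finite_V head_V by (intro sum.cong refl) auto
  finally have *: "(\<Sum>x\<in>V. cinner (S.edge_projection F (P x h)) (P x g)) = \<dots>" .
  have "(\<Sum>x\<in>V. cinner (P x h) (P x g)) = vertex_form h g"
    unfolding vertex_form_def
    by (intro sum.cong refl projection_cinner(2) S.P_projection V_vert)
  with * show ?thesis
    by (simp add: cinner_defect sum_subtractf sum_distrib_left[symmetric])
qed

lemma cinner_kernel_Suc:
  "cinner (kernel (Suc m) b h) (kernel (Suc n) b g) =
    (\<Sum>x\<in>V. cinner (defect (P x h)) b * cinner b (defect (P x g))) +
    of_real (r\<^sup>2) * (\<Sum>e\<in>F. cinner (kernel m b (adj (S e) h)) (kernel n b (adj (S e) g)))"
proof -
  define Z where "Z = kernel (Suc n) b g"
  have vac: "cinner (\<omega> x) Z = cinner b (defect (P x g))" if x: "x \<in> V" for x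
  proof -
    have "cinner (\<omega> x) (L e v) = 0" if "e \<in> F" for e v
      using x that V_vert F_arc
      by (simp add: cinner_adj_left[OF L.S_bops, symmetric] L.adj_S_vacuum)
    then have "cinner (\<omega> x) Z = (\<Sum>y\<in>V. cinner b (defect (P y g)) * cinner (\<omega> x) (\<omega> y))"
      unfolding Z_def
      by (simp add: cinner_add_right cinner_sum_right cinner_scaleC_right cinner_scaleR_right
          cinner_commute[of b, symmetric])
    also have "\<dots> = (\<Sum>y\<in>V. if y = x then cinner b (defect (P y g)) else 0)"
      by (intro sum.cong refl) (use x V_vert in \<open>auto simp: L.cinner_vacuum\<close>)
    finally show ?thesis
      using x finite_V by simp
  qed
  have edge: "cinner (L e v) Z = of_real r * cinner v (kernel n b (adj (S e) g))" if "e \<in> F" for e v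
  proof -
    have "cinner (L e v) Z = cinner v (adj (L e) Z)"
      using F_arc[OF that] by (simp add: cinner_adj_right L.S_bops)
    also have "adj (L e) Z = r *\<^sub>R kernel n b (adj (S e) g)"
      unfolding Z_def using adj_L_kernel[OF that, of "Suc n"] by simp
    finally show ?thesis
      by (simp add: cinner_scaleR_right)
  qed
  show ?thesis
    unfolding Z_def[symmetric]
    by (simp add: cinner_add_left cinner_sum_left cinner_scaleC_left cinner_scaleR_left vac edge
        sum_distrib_left mult.assoc power2_eq_square)
qed

text \<open>
  Summed over \<open>b\<close>, the inner products of the coordinates give \<open>\<langle>K h, K g\<rangle>\<close>. The contributions of
  successive path lengths telescope, which leaves the inner product of the components of \<open>h\<close> and \<open>g\<close>
  in the ranges of the \<open>P\<^sub>x\<close>, \<open>x \<in> V\<close>, up to the remainder of the shorter of the two kernels.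
\<close>

lemma sum_cinner_kernel:
  assumes B: "finite B" "orthonormal_set B"
    and span: "\<And>l x. set l \<subseteq> F \<Longrightarrow> length l < min m n \<Longrightarrow> x \<in> V \<Longrightarrow>
      defect (P x (adj (path_op S l) h)) \<in> cspan B"
  shows "(\<Sum>b\<in>B. cinner (kernel m b h) (kernel n b g)) =
    vertex_form h g - of_real (r ^ (2 * min m n)) * remainder (min m n) h g"
  using span
proof (induction m arbitrary: n h g)
  case 0
  then show ?case
    by simp
next
  case (Suc m)
  show ?case
  proof (cases n)
    case 0
    then show ?thesis
      by simp
  next
    case (Suc k)
    have IH: "(\<Sum>b\<in>B. cinner (kernel m b (adj (S e) h)) (kernel k b (adj (S e) g))) =
      cinner (adj (S e) h) (adj (S e) g)
        - of_real (r ^ (2 * min m k)) * remainder (min m k) (adj (S e) h) (adj (S e) g)"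
      if e: "e \<in> F" for e
    proof -
      have "defect (P x (adj (path_op S l) (adj (S e) h))) \<in> cspan B"
        if "set l \<subseteq> F" "length l < min m k" "x \<in> V" for l x
        using Suc.prems[of "l @ [e]" x] that e Suc F_arcs
        by (auto simp: S.adj_path_op_snoc subset_iff)
      from Suc.IH[OF this] show ?thesis
        by (simp add: vertex_form_adj_S e)
    qed
    have vac: "(\<Sum>b\<in>B. cinner (defect (P x h)) b * cinner b (defect (P x g)))
        = cinner (defect (P x h)) (defect (P x g))" if "x \<in> V" for x
      using Suc.prems[of "[]" x] that Suc by (intro orthonormal_expansion B) (simp add: adj_id)
    have "(\<Sum>b\<in>B. cinner (kernel (Suc m) b h) (kernel n b g))
      = (\<Sum>x\<in>V. \<Sum>b\<in>B. cinner (defect (P x h)) b * cinner b (defect (P x g)))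
        + of_real (r\<^sup>2) * (\<Sum>e\<in>F. \<Sum>b\<in>B. cinner (kernel m b (adj (S e) h)) (kernel k b (adj (S e) g)))"
      unfolding Suc cinner_kernel_Suc sum.distrib sum_distrib_left[symmetric]
      by (subst (1 3) sum.swap) (rule refl)
    also have "\<dots> = vertex_form h g
        - of_real (r\<^sup>2) * (\<Sum>e\<in>F. cinner (adj (S e) h) (adj (S e) g))
        + of_real (r\<^sup>2) * (\<Sum>e\<in>F. cinner (adj (S e) h) (adj (S e) g)
          - of_real (r ^ (2 * min m k)) * remainder (min m k) (adj (S e) h) (adj (S e) g))"
      by (simp add: vac IH sum_cinner_defect)
    also have "\<dots> = vertex_form h g - of_real (r ^ (2 * min (Suc m) n)) * remainder (min (Suc m) n) h g"
      unfolding Suc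
      by (simp add: sum_subtractf sum_distrib_left[symmetric] algebra_simps power2_eq_square)
    finally show ?thesis .
  qed
qed

lemma cmod_vertex_form_le: "cmod (vertex_form h g) \<le> norm h * norm g"
proof -
  have "vertex_form h g = cinner ((\<Sum>x\<in>V. P x) h) g"
    by (simp add: vertex_form_def blinfun.sum_left cinner_sum_left)
  also have "cmod \<dots> \<le> norm ((\<Sum>x\<in>V. P x) h) * norm g"
    by (rule cmod_cinner_le)
  also have "\<dots> \<le> norm h * norm g"
    by (intro mult_right_mono projection_norm_le S.projection_vertex_sum finite_V V_verts) simp
  finally show ?thesis .
qed

text \<open>
  By Bessel's inequality, \<open>h \<mapsto> (S\<^sub>e\<^sup>* h)\<^sub>e\<close> is a contraction into the direct sum, and the recursion
  for the remainder iterates it.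
\<close>

lemma cmod_remainder_le: "cmod (remainder k h g) \<le> norm h * norm g"
proof (induction k arbitrary: h g)
  case 0
  show ?case
    by (simp add: cmod_vertex_form_le)
next
  case (Suc k)
  have L2: "L2_set (\<lambda>e. norm (adj (S e) v)) F \<le> norm v" for v
    unfolding L2_set_def
    using S.adj_S_bessel[OF finite_F F_arcs, of v] by (intro real_le_lsqrt) (auto intro: sum_nonneg)
  have "cmod (remainder (Suc k) h g) \<le> (\<Sum>e\<in>F. cmod (remainder k (adj (S e) h) (adj (S e) g)))"
    by (simp add: norm_sum)
  also have "\<dots> \<le> (\<Sum>e\<in>F. \<bar>norm (adj (S e) h)\<bar> * \<bar>norm (adj (S e) g)\<bar>)"
    using Suc.IH by (intro sum_mono) simp
  also have "\<dots> \<le> L2_set (\<lambda>e. norm (adj (S e) h)) F * L2_set (\<lambda>e. norm (adj (S e) g)) F"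
    by (rule L2_set_mult_ineq)
  also have "\<dots> \<le> norm h * norm g"
    by (intro mult_mono L2) auto
  finally show ?case .
qed

lemma Re_remainder_self: "0 \<le> Re (remainder k h h)"
proof (induction k arbitrary: h)
  case 0
  have "cinner (P x h) h = complex_of_real ((norm (P x h))\<^sup>2)" if "x \<in> V" for x
    by (metis S.P_projection V_vert cinner_self projection_cinner(2) that)
  then show ?case
    by (auto simp: vertex_form_def intro!: sum_nonneg)
qed (auto intro!: sum_nonneg)

lemma sum_norm_kernel_le:
  assumes B: "finite B" "orthonormal_set B"
    and span: "\<And>l x. set l \<subseteq> F \<Longrightarrow> length l < n \<Longrightarrow> x \<in> V \<Longrightarrow>
      defect (P x (adj (path_op S l) h)) \<in> cspan B"
  shows "(\<Sum>b\<in>B. (norm (kernel n b h))\<^sup>2) \<le> (norm h)\<^sup>2"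
proof -
  have "complex_of_real (\<Sum>b\<in>B. (norm (kernel n b h))\<^sup>2)
      = vertex_form h h - complex_of_real (r ^ (2 * n)) * remainder n h h"
    using sum_cinner_kernel[OF B, of n n h h] span by (simp add: cinner_self)
  then have "(\<Sum>b\<in>B. (norm (kernel n b h))\<^sup>2) = Re (vertex_form h h) - r ^ (2 * n) * Re (remainder n h h)"
    by (auto dest: arg_cong[where f = Re])
  also have "\<dots> \<le> Re (vertex_form h h)"
    using Re_remainder_self r_nonneg by simp
  also have "\<dots> \<le> cmod (vertex_form h h)"
    by (rule complex_Re_le_cmod)
  also have "\<dots> \<le> (norm h)\<^sup>2"
    using cmod_vertex_form_le[of h h] by (simp add: power2_eq_square)
  finally show ?thesis .
qed

text \<open>
  The functional is \<open>T \<mapsto> \<langle>(T \<otimes> 1) K h, K g\<rangle>\<close>. Moving \<open>L\<^sub>p\<close> and \<open>L\<^sub>q\<^sup>*\<close> through the kernels produces the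
  factor \<open>r\<^bsup>|p|+|q|\<^esup>\<close> and lowers the truncation length by \<open>|q|\<close> on the left and by \<open>|p|\<close> on the right;
  \<open>n - |p| - |q|\<close> is a common lower bound for the two.
\<close>

lemma poisson_functional:
  obtains \<Psi> :: "'k op \<Rightarrow> complex"
  where "\<And>T U. \<Psi> (T + U) = \<Psi> T + \<Psi> U" "\<And>c T. \<Psi> (scale_op c T) = c * \<Psi> T"
    "\<And>T. cmod (\<Psi> T) \<le> norm T * (norm h * norm g)"
    "\<And>x p q. x \<in> V \<Longrightarrow> set p \<subseteq> F \<Longrightarrow> set q \<subseteq> F \<Longrightarrow>
      cmod (\<Psi> (word_op L R x p q) - of_real (r ^ (length p + length q)) * cinner (word_op S P x p q h) g)
        \<le> r ^ (2 * (n - length p - length q)) * (norm h * norm g)"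
proof -
  \<comment> \<open>The values of \<open>\<Delta>\<close> from which the kernels of \<open>h\<close>, of \<open>g\<close> and of all \<open>P\<^sub>x S\<^sub>q\<^sup>* h\<close> are built.\<close>
  define K where
    "K v = (\<lambda>(x, l). defect (P x (adj (path_op S l) v))) ` (V \<times> {l. set l \<subseteq> F \<and> length l \<le> n})" for v
  define K' where "K' = K h \<union> K g \<union>
    (\<Union>(x, q)\<in>V \<times> {l. set l \<subseteq> F \<and> length l \<le> n}. K (P x (adj (path_op S q) h)))"
  have fin: "finite {l. set l \<subseteq> F \<and> length l \<le> n}"
    using finite_F by (rule finite_lists_length_le)
  then have "finite (K v)" for v
    unfolding K_def using finite_V by blast
  then have "finite K'"
    unfolding K'_def using fin finite_V by auto
  then obtain B where B: "finite B" "orthonormal_set B" and KB: "K' \<subseteq> cspan B"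
    using finite_orthonormal_set_spanning by blast
  have KI: "defect (P x (adj (path_op S l) v)) \<in> K v"
    if "set l \<subseteq> F" "length l \<le> n" "x \<in> V" for x l v
    unfolding K_def using that by force
  define A where "A = kernel n"
  define \<Psi> where "\<Psi> T = (\<Sum>b\<in>B. cinner (T (A b h)) (A b g))" for T :: "'k op"
  have le: "(\<Sum>b\<in>B. (norm (A b v))\<^sup>2) \<le> (norm v)\<^sup>2" if "K v \<subseteq> K'" for v
    unfolding A_def
    by (rule sum_norm_kernel_le[OF B]) (use KI KB that in \<open>auto simp: subset_iff\<close>)
  have L2: "L2_set (\<lambda>b. norm (A b v)) B \<le> norm v" if "K v \<subseteq> K'" for v
    unfolding L2_set_def using le[OF that] by (intro real_le_lsqrt) (auto intro: sum_nonneg)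
  show ?thesis
  proof (rule that[of \<Psi>])
    show "\<Psi> (T + U) = \<Psi> T + \<Psi> U" for T U
      by (simp add: \<Psi>_def blinfun.add_left cinner_add_left sum.distrib)
    show "\<Psi> (scale_op c T) = c * \<Psi> T" for c T
      by (simp add: \<Psi>_def cinner_scaleC_left sum_distrib_left)
    show "cmod (\<Psi> T) \<le> norm T * (norm h * norm g)" for T
    proof -
      have "cmod (\<Psi> T) \<le> (\<Sum>b\<in>B. cmod (cinner (T (A b h)) (A b g)))"
        unfolding \<Psi>_def by (rule norm_sum)
      also have "\<dots> \<le> (\<Sum>b\<in>B. norm T * (\<bar>norm (A b h)\<bar> * \<bar>norm (A b g)\<bar>))"
      proof (intro sum_mono)
        fix b
        have "cmod (cinner (T (A b h)) (A b g)) \<le> norm (T (A b h)) * norm (A b g)"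
          by (rule cmod_cinner_le)
        also have "\<dots> \<le> (norm T * norm (A b h)) * norm (A b g)"
          by (intro mult_right_mono norm_blinfun) simp
        finally show "cmod (cinner (T (A b h)) (A b g))
            \<le> norm T * (\<bar>norm (A b h)\<bar> * \<bar>norm (A b g)\<bar>)"
          by (simp add: mult.assoc)
      qed
      also have "\<dots> \<le> norm T * (L2_set (\<lambda>b. norm (A b h)) B * L2_set (\<lambda>b. norm (A b g)) B)"
        unfolding sum_distrib_left[symmetric] by (intro mult_left_mono L2_set_mult_ineq) simp
      also have "\<dots> \<le> norm T * (norm h * norm g)"
        by (intro mult_left_mono mult_mono L2) (auto simp: K'_def)
      finally show ?thesis .
    qed
    show "cmod (\<Psi> (word_op L R x p q) - of_real (r ^ (length p + length q)) * cinner (word_op S P x p q h) g)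
        \<le> r ^ (2 * (n - length p - length q)) * (norm h * norm g)"
      if x: "x \<in> V" and p: "set p \<subseteq> F" and q: "set q \<subseteq> F" for x p q
    proof -
      define h' where "h' = P x (adj (path_op S q) h)"
      define g' where "g' = adj (path_op S p) g"
      define k where "k = min (n - length q) (n - length p)"
      have arcs: "set p \<subseteq> arcs G" "set q \<subseteq> arcs G"
        using p q F_arcs by auto
      have "cinner (word_op L R x p q (A b h)) (A b g)
          = of_real (r ^ (length p + length q)) *
            cinner (kernel (n - length q) b h') (kernel (n - length p) b g')" for b
        using arcs p q x
        by (simp add: word_op_def A_def L.cinner_path_op adj_path_kernel R_kernel
            blinfun.scaleR_right cinner_scaleR_left cinner_scaleR_right h'_def g'_def power_add)
      then have "\<Psi> (word_op L R x p q) = of_real (r ^ (length p + length q)) *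
          (\<Sum>b\<in>B. cinner (kernel (n - length q) b h') (kernel (n - length p) b g'))"
        by (simp add: \<Psi>_def sum_distrib_left)
      also have "(\<Sum>b\<in>B. cinner (kernel (n - length q) b h') (kernel (n - length p) b g'))
          = cinner h' g' - of_real (r ^ (2 * k)) * remainder k h' g'"
      proof -
        have "defect (P y (adj (path_op S l) h')) \<in> cspan B"
          if l: "set l \<subseteq> F" "length l < min (n - length q) (n - length p)" "y \<in> V" for l y
        proof -
          have "K h' \<subseteq> K'"
            unfolding K'_def h'_def using l q x by force
          then show ?thesis
            using KI[of l y h'] l KB by (meson less_imp_le min_less_iff_conj order_less_le_trans
                diff_le_self subsetD)
        qed
        from sum_cinner_kernel[OF B this] show ?thesis
          using vertex_form_P[OF x] by (simp add: h'_def k_def)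
      qed
      also have "cinner h' g' = cinner (word_op S P x p q h) g"
        using arcs by (simp add: word_op_def h'_def g'_def S.cinner_path_op)
      finally have "\<Psi> (word_op L R x p q) - of_real (r ^ (length p + length q)) * cinner (word_op S P x p q h) g
          = - (of_real (r ^ (length p + length q)) * (of_real (r ^ (2 * k)) * remainder k h' g'))"
        by (simp add: algebra_simps)
      then have "cmod (\<Psi> (word_op L R x p q)
            - of_real (r ^ (length p + length q)) * cinner (word_op S P x p q h) g)
          = r ^ (length p + length q) * (r ^ (2 * k) * cmod (remainder k h' g'))"
        using r_nonneg by (simp add: norm_mult norm_power)
      also have "\<dots> \<le> 1 * (r ^ (2 * (n - length p - length q)) * (norm h * norm g))"
      proof (intro mult_mono)
        show "r ^ (length p + length q) \<le> 1"
          using r_nonneg r_less by (simp add: power_le_one)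
        show "r ^ (2 * k) \<le> r ^ (2 * (n - length p - length q))"
          using r_nonneg r_less by (intro power_decreasing) (auto simp: k_def)
        have "norm h' \<le> norm h"
          unfolding h'_def using S.norm_P_le[OF V_vert[OF x]] S.norm_adj_path_op_le[OF arcs(2)]
          by (meson order_trans)
        moreover have "norm g' \<le> norm g"
          unfolding g'_def by (rule S.norm_adj_path_op_le[OF arcs(1)])
        ultimately show "cmod (remainder k h' g') \<le> norm h * norm g"
          by (meson cmod_remainder_le mult_mono norm_ge_zero order_trans)
      qed (use r_nonneg in auto)
      finally show ?thesis
        by simp
    qed
  qed
qed

end

context toeplitz_vacuum_pair
begin

text \<open>
  With each word weighted by \<open>r\<^bsup>|p|+|q|\<^esup>\<close>, the combination satisfies the estimate for every \<open>r < 1\<close>,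
  by the functionals above for \<open>n \<rightarrow> \<infinity>\<close>. Then \<open>r \<rightarrow> 1\<close> removes the weights.
\<close>

theorem norm_combination_op_le:
  assumes js: "combination_in G js"
  shows "norm (combination_op S P js) \<le> norm (combination_op L R js)"
proof -
  define T where "T = combination_op L R js"
  define F where "F = (\<Union>(c, x, p, q)\<in>set js. set p \<union> set q)"
  define V where "V = (\<lambda>(c, x, p, q). x) ` set js \<union> head G ` F \<union> tail G ` F"
  have FV: "finite F" "F \<subseteq> arcs G" "finite V" "V \<subseteq> verts G"
    using js by (fastforce simp: F_def V_def combination_in_def)+
  have inFV: "x \<in> V" "set p \<subseteq> F" "set q \<subseteq> F" if "(c, x, p, q) \<in> set js" for c x p q
    using that by (force simp: F_def V_def)+
  have bound: "cmod (cinner (combination_op S P js h) g) \<le> norm T * (norm h * norm g)" for h g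
  proof -
    define val where "val ks r = (\<Sum>(c, x, p, q)\<leftarrow>ks.
        c * (of_real (r ^ (length p + length q)) * cinner (word_op S P x p q h) g))" for ks and r :: real
    define err where "err ks r n = (\<Sum>(c, x, p, q)\<leftarrow>ks.
        cmod c * (r ^ (2 * (n - length p - length q)) * (norm h * norm g)))"
      for ks :: "('v, 'e) combination" and r :: real and n
    have val_le: "cmod (val js r) \<le> norm T * (norm h * norm g)" if r: "0 \<le> r" "r < 1" for r
    proof -
      interpret poisson_kernel G L R S P \<omega> F V r
        using FV r by unfold_locales (auto simp: V_def)
      have le: "cmod (val js r) \<le> norm T * (norm h * norm g) + err js r n" for n
      proof -
        obtain \<Psi> :: "'k op \<Rightarrow> complex" where
          add: "\<And>T U. \<Psi> (T + U) = \<Psi> T + \<Psi> U" and scale: "\<And>c T. \<Psi> (scale_op c T) = c * \<Psi> T"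
          and le: "\<And>T. cmod (\<Psi> T) \<le> norm T * (norm h * norm g)"
          and word: "\<And>x p q. x \<in> V \<Longrightarrow> set p \<subseteq> F \<Longrightarrow> set q \<subseteq> F \<Longrightarrow>
            cmod (\<Psi> (word_op L R x p q) - of_real (r ^ (length p + length q)) * cinner (word_op S P x p q h) g)
              \<le> r ^ (2 * (n - length p - length q)) * (norm h * norm g)"
          by (rule poisson_functional[of h g n]) (rule that)
        have zero: "\<Psi> 0 = 0"
          using add[of 0 0] by simp
        have "cmod (\<Psi> (combination_op L R ks) - val ks r) \<le> err ks r n" if "set ks \<subseteq> set js" for ks
          using that
        proof (induction ks)
          case Nil
          then show ?case
            by (simp add: val_def err_def zero)
        next
          case (Cons j ks)
          obtain c x p q where j: "j = (c, x, p, q)"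
            by (cases j)
          have mem: "(c, x, p, q) \<in> set js"
            using Cons.prems by (simp add: j)
          define a where "a = \<Psi> (word_op L R x p q)
            - of_real (r ^ (length p + length q)) * cinner (word_op S P x p q h) g"
          have "cmod a \<le> r ^ (2 * (n - length p - length q)) * (norm h * norm g)"
            unfolding a_def by (intro word inFV[OF mem])
          then have "cmod (c * a) \<le> cmod c * (r ^ (2 * (n - length p - length q)) * (norm h * norm g))"
            by (simp add: norm_mult mult_left_mono)
          moreover have "cmod (\<Psi> (combination_op L R ks) - val ks r) \<le> err ks r n"
            using Cons by simp
          moreover have "\<Psi> (combination_op L R (j # ks)) - val (j # ks) r
              = c * a + (\<Psi> (combination_op L R ks) - val ks r)"
            by (simp add: j a_def val_def add scale algebra_simps)
          ultimately show ?case
            using norm_triangle_ineq[of "c * a" "\<Psi> (combination_op L R ks) - val ks r"]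
            by (simp add: j err_def)
        qed
        from this[OF order_refl] show ?thesis
          using le[of T] norm_triangle_ineq2[of "val js r" "\<Psi> T"]
          unfolding T_def by (simp add: norm_minus_commute)
      qed
      have "(\<lambda>n. err ks r n) \<longlonglongrightarrow> 0" for ks :: "('v, 'e) combination"
      proof (induction ks)
        case Nil
        show ?case
          by (simp add: err_def)
      next
        case (Cons j ks)
        obtain c x p q where j: "j = (c, x, p, q)"
          by (cases j)
        have "filterlim (\<lambda>n. 2 * (n - length p - length q)) at_top sequentially"
          unfolding filterlim_at_top
        proof
          fix Z
          show "\<forall>\<^sub>F n in sequentially. Z \<le> 2 * (n - length p - length q)"
            using eventually_ge_at_top[of "Z + length p + length q"] by eventually_elim simp
        qed
        then have "(\<lambda>n. r ^ (2 * (n - length p - length q))) \<longlonglongrightarrow> 0"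
          using filterlim_compose[OF LIMSEQ_realpow_zero[OF r]] by blast
        then have "(\<lambda>n. cmod c * (r ^ (2 * (n - length p - length q)) * (norm h * norm g)) + err ks r n)
            \<longlonglongrightarrow> cmod c * (0 * (norm h * norm g)) + 0"
          by (intro tendsto_intros Cons.IH)
        then show ?case
          by (simp add: j err_def)
      qed
      from tendsto_add[OF tendsto_const this]
      have "(\<lambda>n. norm T * (norm h * norm g) + err js r n) \<longlonglongrightarrow> norm T * (norm h * norm g) + 0" .
      then show ?thesis
        using le by (intro LIMSEQ_le_const[of _ "norm T * (norm h * norm g)"]) auto
    qed
    have "((\<lambda>r. val ks r) \<longlongrightarrow> val ks 1) (at_left 1)" for ks
    proof (induction ks)
      case Nil
      show ?case
        by (simp add: val_def)
    next
      case (Cons j ks)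
      obtain c x p q where j: "j = (c, x, p, q)"
        by (cases j)
      have "((\<lambda>r. c * (complex_of_real (r ^ (length p + length q)) * cinner (word_op S P x p q h) g)
          + val ks r) \<longlongrightarrow> c * (complex_of_real (1 ^ (length p + length q))
            * cinner (word_op S P x p q h) g) + val ks 1) (at_left 1)"
        by (intro tendsto_intros Cons.IH)
      then show ?case
        by (simp add: j val_def)
    qed
    then have "((\<lambda>r. cmod (val js r)) \<longlongrightarrow> cmod (val js 1)) (at_left 1)"
      by (intro tendsto_norm)
    moreover have "\<forall>\<^sub>F r in at_left (1 :: real). cmod (val js r) \<le> norm T * (norm h * norm g)"
      using eventually_at_left_real[of 0 "1 :: real"] by (auto elim!: eventually_mono intro: val_le)
    ultimately have "cmod (val js 1) \<le> norm T * (norm h * norm g)"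
      by (rule tendsto_upperbound) simp
    moreover have "val ks 1 = cinner (combination_op S P ks h) g" for ks
    proof (induction ks)
      case (Cons j ks)
      then show ?case
        by (cases j) (simp add: val_def blinfun.add_left cinner_add_left cinner_scaleC_left)
    qed (simp add: val_def)
    ultimately show ?thesis
      by simp
  qed
  have "norm (combination_op S P js h) \<le> norm T * norm h" for h
  proof (cases "combination_op S P js h = 0")
    case False
    define y where "y = combination_op S P js h"
    have "norm y * norm y \<le> (norm T * norm h) * norm y"
      using bound[of h y] unfolding y_def[symmetric]
      by (simp add: cinner_self power2_eq_square norm_mult mult.assoc)
    then show ?thesis
      using False by (simp add: y_def)
  qed simp
  then show ?thesis
    unfolding T_def[symmetric] by (intro norm_blinfun_bound) auto
qed

end


section \<open>Paths and the vectors they create\<close>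

context wf_digraph
begin

lemma Nil_in_free_semigroupoid: "(x, []) \<in> free_semigroupoid G \<longleftrightarrow> x \<in> verts G"
  by (auto simp: free_semigroupoid_def awalk_Nil_iff)

lemma path_range_Nil [simp]: "path_range G (x, []) = x"
  by (simp add: path_range_def)

lemma path_range_snoc [simp]: "path_range G (x, p @ [e]) = head G e"
  by (induction p arbitrary: x) (auto simp: path_range_def)

lemma free_semigroupoid_iff:
  "(x, p) \<in> free_semigroupoid G \<longleftrightarrow> awalk x p (path_range G (x, p))"
  by (auto simp: free_semigroupoid_def path_range_def)

lemma snoc_in_free_semigroupoid:
  "(x, p @ [e]) \<in> free_semigroupoid G \<longleftrightarrow>
    (x, p) \<in> free_semigroupoid G \<and> e \<in> arcs G \<and> path_range G (x, p) = tail G e"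
proof -
  have "awalk x (p @ [e]) (path_range G (x, p @ [e])) \<longleftrightarrow>
      awalk x p (path_range G (x, p)) \<and> awalk (path_range G (x, p)) [e] (path_range G (x, p @ [e]))"
    unfolding awalk_append_iff by (simp add: path_range_def)
  also have "\<dots> \<longleftrightarrow>
      awalk x p (path_range G (x, p)) \<and> e \<in> arcs G \<and> path_range G (x, p) = tail G e"
    by (auto simp: awalk_simps)
  finally show ?thesis
    by (simp add: free_semigroupoid_iff)
qed

lemma path_range_in_verts: "w \<in> free_semigroupoid G \<Longrightarrow> path_range G w \<in> verts G"
  by (cases w) (auto simp: free_semigroupoid_iff)

end

context toeplitz_vacuum
begin

definition path_vector :: "('v, 'e) path \<Rightarrow> 'a" where
  "path_vector w = path_op S (snd w) (\<omega> (fst w))"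

lemma path_vector_Nil: "path_vector (x, []) = \<omega> x"
  by (simp add: path_vector_def)

lemma path_vector_snoc: "path_vector (x, p @ [e]) = S e (path_vector (x, p))"
  by (simp add: path_vector_def path_op_snoc)

lemma P_path_vector:
  assumes "w \<in> free_semigroupoid G" "x \<in> verts G"
  shows "P x (path_vector w) = (if path_range G w = x then path_vector w else 0)"
proof (cases "snd w" rule: rev_cases)
  case Nil
  then have "w = (fst w, [])"
    by (cases w) simp
  then obtain y where w: "w = (y, [])"
    by blast
  have y: "y \<in> verts G"
    using assms(1) unfolding w Nil_in_free_semigroupoid .
  have "P x (\<omega> y) = (if y = x then \<omega> y else 0)"
    using P_P[OF assms(2) y, of "\<omega> y"] y by (auto simp: P_vacuum)
  then show ?thesis
    unfolding w by (simp add: path_vector_Nil)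
next
  case (snoc p e)
  then have "w = (fst w, p @ [e])"
    by (cases w) simp
  then obtain y where w: "w = (y, p @ [e])"
    by blast
  show ?thesis
    using assms unfolding w by (auto simp: path_vector_snoc P_S snoc_in_free_semigroupoid)
qed

lemma S_path_vector:
  assumes "w \<in> free_semigroupoid G" "e \<in> arcs G"
  shows "S e (path_vector w) =
    (if path_range G w = tail G e then path_vector (edge_times e w) else 0)"
proof (cases "path_range G w = tail G e")
  case True
  then show ?thesis
    by (cases w) (simp add: edge_times_def path_vector_snoc)
next
  case False
  have "S e (path_vector w) = S e (P (path_range G w) (path_vector w))"
    using assms by (simp add: P_path_vector path_range_in_verts)
  then show ?thesis
    using False assms S_P[OF path_range_in_verts[OF assms(1)] assms(2)] by simp
qed

lemma adj_S_path_vector_Nil: "(x, []) \<in> free_semigroupoid G \<Longrightarrow> e \<in> arcs G \<Longrightarrow>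
    adj (S e) (path_vector (x, [])) = 0"
  by (simp add: path_vector_Nil adj_S_vacuum Nil_in_free_semigroupoid)

lemma adj_S_path_vector_snoc: "(x, p @ [f]) \<in> free_semigroupoid G \<Longrightarrow> e \<in> arcs G \<Longrightarrow>
    adj (S e) (path_vector (x, p @ [f])) = (if e = f then path_vector (x, p) else 0)"
  by (auto simp: path_vector_snoc adj_S_S P_path_vector snoc_in_free_semigroupoid)

text \<open>
  The common last edges of two paths can be removed by \<open>S\<^sub>e\<^sup>*\<close>. Distinct paths then either end in
  distinct edges, or one of them is trivial and its vector is annihilated.
\<close>

lemma cinner_path_vector:
  assumes "w \<in> free_semigroupoid G" "v \<in> free_semigroupoid G"
  shows "cinner (path_vector w) (path_vector v) = (if w = v then 1 else 0)"
proof -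
  have "cinner (path_vector (x, p)) (path_vector (y, q)) = (if (x, p) = (y, q) then 1 else 0)"
    if "(x, p) \<in> free_semigroupoid G" "(y, q) \<in> free_semigroupoid G" for x y p q
    using that
  proof (induction p arbitrary: q rule: rev_induct)
    case Nil
    then have x: "x \<in> verts G"
      by (simp add: Nil_in_free_semigroupoid)
    show ?case
    proof (cases q rule: rev_cases)
      case Nil
      then show ?thesis
        using x \<open>(y, q) \<in> _\<close> by (simp add: path_vector_Nil cinner_vacuum Nil_in_free_semigroupoid)
    next
      case (snoc q' f)
      then have f: "f \<in> arcs G"
        using \<open>(y, q) \<in> _\<close> by (simp add: snoc_in_free_semigroupoid)
      have "cinner (path_vector (x, [])) (path_vector (y, q))
          = cinner (adj (S f) (\<omega> x)) (path_vector (y, q'))"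
        by (simp add: snoc path_vector_Nil path_vector_snoc cinner_adj_left S_bops f)
      then show ?thesis
        using x f snoc by (simp add: adj_S_vacuum)
    qed
  next
    case (snoc e p)
    then have e: "e \<in> arcs G" and xp: "(x, p) \<in> free_semigroupoid G"
      by (simp_all add: snoc_in_free_semigroupoid)
    have *: "cinner (path_vector (x, p @ [e])) (path_vector (y, q))
        = cinner (path_vector (x, p)) (adj (S e) (path_vector (y, q)))"
      by (simp add: path_vector_snoc cinner_adj_right S_bops e)
    show ?case
    proof (cases q rule: rev_cases)
      case Nil
      then show ?thesis
        unfolding * using snoc.prems(2) e by (simp add: adj_S_path_vector_Nil)
    next
      case q: (snoc q' f)
      then have "(y, q') \<in> free_semigroupoid G"
        using snoc.prems(2) by (simp add: snoc_in_free_semigroupoid)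
      then show ?thesis
        unfolding * using snoc.IH[OF xp, of q'] snoc.prems(2) e
        by (auto simp: q adj_S_path_vector_snoc)
    qed
  qed
  then show ?thesis
    using assms by (cases w, cases v) blast
qed

end


section \<open>The left regular representation\<close>

locale fock_space = wf_digraph G for G :: "('v, 'e) pre_digraph" +
  fixes \<xi> :: "('v, 'e) path \<Rightarrow> 'k::chilbert_space"
  assumes basis: "orthonormal_basis \<xi> (free_semigroupoid G)"
begin

lemma cinner_basis: "w \<in> free_semigroupoid G \<Longrightarrow> v \<in> free_semigroupoid G \<Longrightarrow>
    cinner (\<xi> w) (\<xi> v) = (if w = v then 1 else 0)"
  using basis by (simp add: orthonormal_basis_def)

lemma norm_basis: "w \<in> free_semigroupoid G \<Longrightarrow> norm (\<xi> w) = 1"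
  by (simp add: norm_eq_oneI cinner_basis)

text \<open>
  A partial injection of the basis into itself extends to a bounded operator. Creation operators,
  their adjoints and the vertex projections are all of this form.
\<close>

lemma basis_map:
  assumes "\<And>w. w \<in> D \<Longrightarrow> f w \<in> free_semigroupoid G" "inj_on f D"
  obtains T where "T \<in> bops"
    "\<And>w. w \<in> free_semigroupoid G \<Longrightarrow> T (\<xi> w) = (if w \<in> D then \<xi> (f w) else 0)"
proof (rule basis_extension[OF basis, of "\<lambda>w. if w \<in> D then \<xi> (f w) else 0"])
  fix w v assume "w \<in> free_semigroupoid G" "v \<in> free_semigroupoid G" "w \<noteq> v"
  then show "cinner (if w \<in> D then \<xi> (f w) else 0) (if v \<in> D then \<xi> (f v) else 0) = 0"
    using assms by (auto simp: cinner_basis inj_on_eq_iff)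
next
  fix w assume "w \<in> free_semigroupoid G"
  then show "norm (if w \<in> D then \<xi> (f w) else 0) \<le> 1"
    using assms by (auto simp: norm_basis)
qed (use that complex_linear_iff_bops in blast)

abbreviation L :: "'e \<Rightarrow> 'k op" where "L \<equiv> creation_op G \<xi>"
abbreviation R :: "'v \<Rightarrow> 'k op" where "R \<equiv> vertex_proj G \<xi>"

lemma bops_basis_eqI:
  "T \<in> bops \<Longrightarrow> U \<in> bops \<Longrightarrow>
    (\<And>w. w \<in> free_semigroupoid G \<Longrightarrow> T (\<xi> w) = U (\<xi> w)) \<Longrightarrow> T = U"
  by (rule basis_eqI[OF basis]) (auto simp: complex_linear_iff_bops)

lemma adj_basis_eqI:
  assumes "T \<in> bops" "U \<in> bops"
    and "\<And>w v. w \<in> free_semigroupoid G \<Longrightarrow> v \<in> free_semigroupoid G \<Longrightarrow>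
      cinner (T (\<xi> w)) (\<xi> v) = cinner (\<xi> w) (U (\<xi> v))"
  shows "adj T = U"
proof (rule adj_eqI[OF assms(2)])
  show "cinner (T x) y = cinner x (U y)" for x y
    using cinner_basis_eqI[OF basis, of T id_blinfun id_blinfun U x y] assms id_bops
    by (simp add: complex_linear_iff_bops)
qed

lemma
  assumes e: "e \<in> arcs G"
  shows creation_op_bops: "L e \<in> bops"
    and creation_op_basis: "w \<in> free_semigroupoid G \<Longrightarrow>
      L e (\<xi> w) = (if path_range G w = tail G e then \<xi> (edge_times e w) else 0)"
proof -
  define D where "D = {w \<in> free_semigroupoid G. path_range G w = tail G e}"
  have "edge_times e w \<in> free_semigroupoid G" if "w \<in> D" for w
    using that e by (cases w) (auto simp: D_def edge_times_def snoc_in_free_semigroupoid)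
  moreover have "inj_on (edge_times e) D"
    by (auto simp: inj_on_def edge_times_def prod_eq_iff)
  ultimately obtain T where T: "T \<in> bops"
    "\<And>w. w \<in> free_semigroupoid G \<Longrightarrow> T (\<xi> w) = (if w \<in> D then \<xi> (edge_times e w) else 0)"
    using basis_map by blast
  have "L e = T"
    unfolding creation_op_def
    by (rule the_equality) (use T in \<open>auto simp: D_def intro!: bops_basis_eqI\<close>)
  with T show "L e \<in> bops" "w \<in> free_semigroupoid G \<Longrightarrow>
      L e (\<xi> w) = (if path_range G w = tail G e then \<xi> (edge_times e w) else 0)"
    by (auto simp: D_def)
qed

lemma adj_creation_op_basis:
  assumes e: "e \<in> arcs G" and w: "w \<in> free_semigroupoid G"
  shows "adj (L e) (\<xi> w) =
    (if snd w \<noteq> [] \<and> last (snd w) = e then \<xi> (fst w, butlast (snd w)) else 0)"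
proof -
  define D where "D = {w \<in> free_semigroupoid G. snd w \<noteq> [] \<and> last (snd w) = e}"
  define f where "f w = (fst w, butlast (snd w))" for w :: "('v, 'e) path"
  have snocD: "\<exists>x p. w = (x, p @ [e]) \<and> (x, p) \<in> free_semigroupoid G \<and> path_range G (x, p) = tail G e"
    if "w \<in> D" for w
    using that by (cases w, cases "snd w" rule: rev_cases) (auto simp: D_def snoc_in_free_semigroupoid)
  have "f w \<in> free_semigroupoid G" if "w \<in> D" for w
    using snocD[OF that] by (auto simp: f_def)
  moreover have "inj_on f D"
    by (rule inj_onI) (auto simp: f_def dest!: snocD)
  ultimately obtain T where T: "T \<in> bops"
    "\<And>w. w \<in> free_semigroupoid G \<Longrightarrow> T (\<xi> w) = (if w \<in> D then \<xi> (f w) else 0)"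
    using basis_map by blast
  have "adj (L e) = T"
  proof (rule adj_basis_eqI[OF creation_op_bops[OF e] T(1)])
    fix w v assume wv: "w \<in> free_semigroupoid G" "v \<in> free_semigroupoid G"
    have "cinner (L e (\<xi> w)) (\<xi> v) = (if path_range G w = tail G e \<and> edge_times e w = v then 1 else 0)"
      using wv e by (cases w) (auto simp: creation_op_basis cinner_basis edge_times_def
          snoc_in_free_semigroupoid)
    also have "\<dots> = (if v \<in> D \<and> f v = w then 1 else 0)"
    proof -
      have "path_range G w = tail G e \<and> edge_times e w = v \<longleftrightarrow> v \<in> D \<and> f v = w"
      proof
        assume "path_range G w = tail G e \<and> edge_times e w = v"
        then show "v \<in> D \<and> f v = w"
          using wv by (auto simp: edge_times_def f_def D_def)
      next
        assume v: "v \<in> D \<and> f v = w"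
        then obtain x p where "v = (x, p @ [e])" "path_range G (x, p) = tail G e"
          using snocD by blast
        then show "path_range G w = tail G e \<and> edge_times e w = v"
          using v by (auto simp: edge_times_def f_def)
      qed
      then show ?thesis
        by simp
    qed
    also have "\<dots> = cinner (\<xi> w) (T (\<xi> v))"
      using wv snocD[of v] by (auto simp: T cinner_basis f_def)
    finally show "cinner (L e (\<xi> w)) (\<xi> v) = cinner (\<xi> w) (T (\<xi> v))" .
  qed
  then show ?thesis
    using w by (simp add: T D_def f_def)
qed

lemma
  shows projection_vertex_proj: "projection (R x)"
    and vertex_proj_basis: "w \<in> free_semigroupoid G \<Longrightarrow>
      R x (\<xi> w) = (if path_range G w = x then \<xi> w else 0)"
proof -
  define D where "D = {w \<in> free_semigroupoid G. path_range G w = x}"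
  obtain T where T: "T \<in> bops"
    "\<And>w. w \<in> free_semigroupoid G \<Longrightarrow> T (\<xi> w) = (if w \<in> D then \<xi> w else 0)"
    using basis_map[of D "\<lambda>w. w"] by (auto simp: D_def)
  have idem: "T o\<^sub>L T = T"
    by (rule bops_basis_eqI) (auto simp: T bops_compose)
  have "adj T = T"
    by (rule adj_basis_eqI) (auto simp: T cinner_basis D_def)
  then have proj: "projection T"
    using T(1) idem by (simp add: projection_def)
  define M where "M = {\<xi> w |w. w \<in> free_semigroupoid G \<and> path_range G w = x}"
  have TT: "T (T v) = T v" for v
    using proj by (rule projectionD)
  have "range (blinfun_apply T) = closure (cspan M)"
  proof
    have "T v \<in> closure (cspan M)" for v
    proof -
      have "v \<in> {v. T v \<in> closure (cspan M)}"
      proof (rule orthonormal_basis_total[OF basis])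
        have "closed (blinfun_apply T -` closure (cspan M))"
          by (intro closed_vimage closed_closure continuous_intros)
        then show "closed {v. T v \<in> closure (cspan M)}"
          by (simp add: vimage_def)
        show "csubspace {v. T v \<in> closure (cspan M)}"
          using csubspace_closure[OF complex_vs.subspace_span, of M]
          by (auto simp: complex_vs.subspace_def blinfun.add_right bopsD[OF T(1)])
        have "\<xi> w \<in> closure (cspan M)" if "w \<in> D" for w
        proof -
          have "\<xi> w \<in> M"
            using that unfolding M_def D_def by blast
          then show ?thesis
            by (intro subsetD[OF closure_subset] complex_vs.span_base)
        qed
        moreover have "0 \<in> closure (cspan M)"
          by (intro subsetD[OF closure_subset] complex_vs.span_zero)
        ultimately show "\<xi> w \<in> {v. T v \<in> closure (cspan M)}" if "w \<in> free_semigroupoid G" for w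
          using that by (auto simp: T)
      qed
      then show ?thesis
        by simp
    qed
    then show "range (blinfun_apply T) \<subseteq> closure (cspan M)"
      by blast
    have "closure (cspan M) \<subseteq> {v. T v = v}"
    proof (intro closure_minimal complex_vs.span_minimal)
      show "closed {v. T v = v}"
        by (intro closed_Collect_eq continuous_intros)
      show "csubspace {v. T v = v}"
        by (auto simp: complex_vs.subspace_def blinfun.add_right bopsD[OF T(1)])
      show "M \<subseteq> {v. T v = v}"
        by (auto simp: M_def T D_def)
    qed
    then show "closure (cspan M) \<subseteq> range (blinfun_apply T)"
      by (metis (mono_tags, lifting) mem_Collect_eq rangeI subset_iff)
  qed
  then have "R x = T"
    unfolding vertex_proj_def proj_onto_def M_def[symmetric]
    by (intro the_equality) (use proj in \<open>auto intro!: projection_eqI\<close>)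
  then show "projection (R x)" "w \<in> free_semigroupoid G \<Longrightarrow>
      R x (\<xi> w) = (if path_range G w = x then \<xi> w else 0)"
    using proj T(2) by (auto simp: D_def)
qed

lemma edge_times_in: "w \<in> free_semigroupoid G \<Longrightarrow> e \<in> arcs G \<Longrightarrow> path_range G w = tail G e \<Longrightarrow>
    edge_times e w \<in> free_semigroupoid G"
  by (cases w) (simp add: edge_times_def snoc_in_free_semigroupoid)

sublocale toeplitz_vacuum G L R "\<lambda>x. \<xi> (x, [])"
proof unfold_locales
  have bops: "R x \<in> bops" for x
    using projection_vertex_proj by (rule projectionD)
  fix e f x y
  show "e \<in> arcs G \<Longrightarrow> L e \<in> bops"
    by (rule creation_op_bops)
  show "projection (R x)"
    by (rule projection_vertex_proj)
  show "x \<noteq> y \<Longrightarrow> R x o\<^sub>L R y = 0"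
    by (rule bops_basis_eqI) (auto simp: bops_compose bops vertex_proj_basis)
  show "e \<in> arcs G \<Longrightarrow> f \<in> arcs G \<Longrightarrow> e \<noteq> f \<Longrightarrow> adj (L e) o\<^sub>L L f = 0"
    by (rule bops_basis_eqI) (auto simp: bops_compose adj_bops creation_op_bops creation_op_basis
        adj_creation_op_basis edge_times_in, auto simp: edge_times_def)
  show "e \<in> arcs G \<Longrightarrow> adj (L e) o\<^sub>L L e = R (tail G e)"
    by (rule bops_basis_eqI) (auto simp: bops_compose adj_bops creation_op_bops creation_op_basis
        adj_creation_op_basis edge_times_in bops vertex_proj_basis, auto simp: edge_times_def)
  show "e \<in> arcs G \<Longrightarrow> R (head G e) o\<^sub>L L e = L e"
    by (rule bops_basis_eqI) (auto simp: bops_compose creation_op_bops creation_op_basis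
        edge_times_in bops vertex_proj_basis, auto simp: edge_times_def)
  show "x \<in> verts G \<Longrightarrow> norm (\<xi> (x, [])) = 1"
    by (simp add: norm_basis Nil_in_free_semigroupoid)
  show "x \<in> verts G \<Longrightarrow> R x (\<xi> (x, [])) = \<xi> (x, [])"
    by (simp add: vertex_proj_basis Nil_in_free_semigroupoid)
  show "x \<in> verts G \<Longrightarrow> e \<in> arcs G \<Longrightarrow> adj (L e) (\<xi> (x, [])) = 0"
    by (simp add: adj_creation_op_basis Nil_in_free_semigroupoid)
qed

end


section \<open>Wandering vectors\<close>

locale fock_space_pair =
  fock_space G \<xi> + S: toeplitz_vacuum G S P \<eta>
  for G :: "('v, 'e) pre_digraph" and \<xi> :: "('v, 'e) path \<Rightarrow> 'k::chilbert_space"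
    and S :: "'e \<Rightarrow> 'h::chilbert_space op" and P :: "'v \<Rightarrow> 'h op" and \<eta> :: "'v \<Rightarrow> 'h"
begin

sublocale toeplitz_vacuum_pair G L R S P "\<lambda>x. \<xi> (x, [])"
  by unfold_locales

text \<open>
  The left regular representation embeds into every family with wandering vectors.
\<close>

lemma wandering_isometry:
  obtains U :: "'k \<Rightarrow>\<^sub>L 'h" where "\<And>v. norm (U v) = norm v"
    "\<And>e v. e \<in> arcs G \<Longrightarrow> U (L e v) = S e (U v)"
    "\<And>e v. e \<in> arcs G \<Longrightarrow> U (adj (L e) v) = adj (S e) (U v)"
    "\<And>x v. x \<in> verts G \<Longrightarrow> U (R x v) = P x (U v)"
    "\<And>c v. U (c *\<^sub>C v) = c *\<^sub>C U v"
proof (rule basis_extension[OF basis, of S.path_vector])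
  show "cinner (S.path_vector w) (S.path_vector v) = 0"
    if "w \<in> free_semigroupoid G" "v \<in> free_semigroupoid G" "w \<noteq> v" for w v
    using that by (simp add: S.cinner_path_vector)
  show "norm (S.path_vector w) \<le> 1" if "w \<in> free_semigroupoid G" for w
    by (simp add: norm_eq_oneI S.cinner_path_vector that)
  fix U :: "'k \<Rightarrow>\<^sub>L 'h"
  assume U: "complex_linear U"
    and U\<xi>: "\<And>w. w \<in> free_semigroupoid G \<Longrightarrow> U (\<xi> w) = S.path_vector w"
  note lin = U[unfolded complex_linear_def, rule_format]
  have intertwine: "U (T v) = T' (U v)"
    if "T \<in> bops" "T' \<in> bops"
      and "\<And>w. w \<in> free_semigroupoid G \<Longrightarrow> U (T (\<xi> w)) = T' (S.path_vector w)" for T T' v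
  proof -
    have "U o\<^sub>L T = T' o\<^sub>L U"
      by (rule basis_eqI[OF basis])
        (use that U\<xi> in \<open>auto simp: complex_linear_def lin bopsD\<close>)
    then show ?thesis
      by (metis blinfun_apply_blinfun_compose)
  qed
  show thesis
  proof (rule that)
    show "norm (U v) = norm v" for v
    proof -
      have "cinner (U v) (U v) = cinner (id_blinfun v) (id_blinfun v)"
        by (rule cinner_basis_eqI[OF basis])
          (auto simp: U U\<xi> complex_linear_iff_bops id_bops cinner_basis S.cinner_path_vector)
      then have "complex_of_real ((norm (U v))\<^sup>2) = complex_of_real ((norm v)\<^sup>2)"
        by (simp only: cinner_self blinfun_apply_id_blinfun id_apply)
      then show ?thesis
        by (simp add: power2_eq_iff_nonneg flip: of_real_power)
    qed
    show "U (c *\<^sub>C v) = c *\<^sub>C U v" for c v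
      by (rule lin)
    show "U (R x v) = P x (U v)" if "x \<in> verts G" for x v
      by (rule intertwine)
        (use that in \<open>auto simp: P_bops S.P_bops vertex_proj_basis S.P_path_vector U\<xi>\<close>)
    show "U (L e v) = S e (U v)" if "e \<in> arcs G" for e v
      by (rule intertwine)
        (use that in \<open>auto simp: S_bops S.S_bops creation_op_basis S.S_path_vector U\<xi> edge_times_in\<close>)
    show "U (adj (L e) v) = adj (S e) (U v)" if e: "e \<in> arcs G" for e v
    proof (rule intertwine)
      fix w assume w: "w \<in> free_semigroupoid G"
      show "U (adj (L e) (\<xi> w)) = adj (S e) (S.path_vector w)"
      proof (cases "snd w" rule: rev_cases)
        case Nil
        then obtain x where "w = (x, [])"
          by (cases w) simp
        then show ?thesis
          using w e by (simp add: adj_creation_op_basis S.adj_S_path_vector_Nil)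
      next
        case (snoc p f)
        then obtain x where "w = (x, p @ [f])"
          by (cases w) simp
        then show ?thesis
          using w e by (auto simp: adj_creation_op_basis S.adj_S_path_vector_snoc U\<xi>
              snoc_in_free_semigroupoid)
      qed
    qed (use e in \<open>auto intro: adj_bops S_bops S.S_bops\<close>)
  qed
qed

lemma norm_combination_op_ge:
  assumes "combination_in G js"
  shows "norm (combination_op L R js) \<le> norm (combination_op S P js)"
proof -
  obtain U :: "'k \<Rightarrow>\<^sub>L 'h" where norm: "\<And>v. norm (U v) = norm v"
    and S: "\<And>e v. e \<in> arcs G \<Longrightarrow> U (L e v) = S e (U v)"
    and adj_S: "\<And>e v. e \<in> arcs G \<Longrightarrow> U (adj (L e) v) = adj (S e) (U v)"
    and P: "\<And>x v. x \<in> verts G \<Longrightarrow> U (R x v) = P x (U v)"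
    and lin: "\<And>c v. U (c *\<^sub>C v) = c *\<^sub>C U v"
    by (rule wandering_isometry) (rule that)
  have path: "U (path_op L p v) = path_op S p (U v)" if "set p \<subseteq> arcs G" for p v
    using that by (induction p arbitrary: v) (auto simp: S)
  have adj_path: "U (adj (path_op L p) v) = adj (path_op S p) (U v)" if "set p \<subseteq> arcs G" for p v
    using that by (induction p arbitrary: v)
      (auto simp: adj_S adj_id adj_path_op_Cons S.adj_path_op_Cons simp del: path_op.simps(2))
  have U: "U (combination_op L R js v) = combination_op S P js (U v)" for v
    using assms
  proof (induction js)
    case Nil
    show ?case
      by (simp add: blinfun.zero_right)
  next
    case (Cons j js)
    then show ?case
      by (cases j) (auto simp: blinfun.add_left blinfun.add_right lin word_op_def path adj_path P)
  qed
  show ?thesis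
  proof (rule norm_blinfun_bound)
    fix v
    have "norm (combination_op L R js v) = norm (combination_op S P js (U v))"
      by (simp flip: norm U)
    also have "\<dots> \<le> norm (combination_op S P js) * norm (U v)"
      by (rule norm_blinfun)
    finally show "norm (combination_op L R js v) \<le> norm (combination_op S P js) * norm v"
      by (simp add: norm)
  qed simp
qed

lemma norm_word_graph: "(T, T') \<in> word_graph \<Longrightarrow> norm T' = norm T"
  by (auto elim!: word_graphE intro: antisym norm_combination_op_le norm_combination_op_ge)

end


section \<open>Families satisfying the relations\<close>

context partial_isometry_family
begin

context
  fixes x :: 'v
  assumes summable: "sot_summable (\<lambda>e. S e o\<^sub>L adj (S e)) {e \<in> arcs G. head G e = x}"
begin

text \<open>
  The finite partial sums are projections, so the limit is a contraction and \<open>range_sum\<close> is indeed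
  the operator given by the pointwise sum.
\<close>

lemma range_sum_has_sum:
  "((\<lambda>e. S e (adj (S e) v)) has_sum range_sum G S x v) {e \<in> arcs G. head G e = x}"
proof -
  define I where "I = {e \<in> arcs G. head G e = x}"
  define Q where "Q v = (\<Sum>\<^sub>\<infinity>e\<in>I. S e (adj (S e) v))" for v
  have Q: "((\<lambda>e. S e (adj (S e) v)) has_sum Q v) I" for v
    using summable unfolding Q_def sot_summable_def I_def by (auto intro: has_sum_infsum)
  have add: "Q (v + w) = Q v + Q w" for v w
    using has_sum_unique[OF Q[of "v + w"]] has_sum_add[OF Q[of v] Q[of w]]
    by (simp add: blinfun.add_right)
  have scale: "Q (a *\<^sub>R v) = a *\<^sub>R Q v" for a v
    using has_sum_unique[OF Q[of "a *\<^sub>R v"]] has_sum_scaleR[OF Q[of v], of a]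
    by (simp add: blinfun.scaleR_right)
  have "norm (Q v) \<le> norm v" for v
  proof -
    have "((\<lambda>F. norm (\<Sum>e\<in>F. S e (adj (S e) v))) \<longlongrightarrow> norm (Q v)) (finite_subsets_at_top I)"
      using Q[of v] unfolding has_sum_def by (intro tendsto_norm)
    moreover have "\<forall>\<^sub>F F in finite_subsets_at_top I. norm (\<Sum>e\<in>F. S e (adj (S e) v)) \<le> norm v"
    proof (rule eventually_finite_subsets_at_top_weakI)
      fix F assume "finite F" "F \<subseteq> I"
      then have "projection (edge_projection F)"
        by (intro projection_edge_projection) (auto simp: I_def)
      from projection_norm_le[OF this, of v] show "norm (\<Sum>e\<in>F. S e (adj (S e) v)) \<le> norm v"
        by (simp add: edge_projection_apply)
    qed
    ultimately show ?thesis
      by (rule tendsto_upperbound) simp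
  qed
  then have "bounded_linear Q"
    by (intro bounded_linear_intro[where K = 1] add scale) simp
  moreover have "range_sum G S x = Blinfun Q"
    by (simp add: range_sum_def sot_sum_def Q_def[abs_def] I_def)
  ultimately show ?thesis
    using Q[of v] by (simp add: bounded_linear_Blinfun_apply I_def)
qed

lemma adj_S_range_sum:
  assumes "e \<in> arcs G" "head G e = x"
  shows "adj (S e) (range_sum G S x v) = adj (S e) v"
proof -
  have "((\<lambda>f. adj (S e) (S f (adj (S f) v))) has_sum adj (S e) (range_sum G S x v))
      {e \<in> arcs G. head G e = x}"
    by (rule has_sum_bounded_linear[OF blinfun.bounded_linear_right range_sum_has_sum])
  moreover have "((\<lambda>f. adj (S e) (S f (adj (S f) v))) has_sum adj (S e) v)
      {e \<in> arcs G. head G e = x}"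
  proof -
    have "((\<lambda>_. adj (S e) v) has_sum adj (S e) v) {e}"
      by (rule has_sum_finiteI) auto
    moreover have "((\<lambda>f. adj (S e) (S f (adj (S f) v))) has_sum adj (S e) v)
        {e \<in> arcs G. head G e = x} \<longleftrightarrow> ((\<lambda>_. adj (S e) v) has_sum adj (S e) v) {e}"
      by (rule has_sum_cong_neutral) (use assms in \<open>auto simp: adj_S_S P_adj_S\<close>)
    ultimately show ?thesis
      by simp
  qed
  ultimately show ?thesis
    by (rule has_sum_unique)
qed

lemma norm_adj_S_le_range_sum:
  assumes "e \<in> arcs G" "head G e = x"
  shows "(norm (adj (S e) v))\<^sup>2 \<le> inner (range_sum G S x v) v"
proof (rule has_sum_mono_neutral)
  have sq: "inner (S f (adj (S f) v)) v = (norm (adj (S f) v))\<^sup>2" if "f \<in> arcs G" for f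
  proof -
    have "cinner (S f (adj (S f) v)) v = cinner (adj (S f) v) (adj (S f) v)"
      using that by (simp add: cinner_adj_right S_bops)
    from arg_cong[OF this, of Re] show ?thesis
      by (simp add: Re_cinner power2_norm_eq_inner)
  qed
  show "((\<lambda>f. inner (S f (adj (S f) v)) v) has_sum inner (range_sum G S x v) v)
      {e \<in> arcs G. head G e = x}"
    by (rule has_sum_bounded_linear[OF bounded_linear_inner_left range_sum_has_sum])
  show "((\<lambda>f. inner (S f (adj (S f) v)) v) has_sum (norm (adj (S e) v))\<^sup>2) {e}"
    using assms by (intro has_sum_finiteI) (auto simp: sq)
qed (use assms in \<open>auto simp: cinner_adj_right S_bops Re_cinner[symmetric] cinner_self
      cinner_adj_right[OF S_bops, symmetric]\<close>)

end

end

text \<open>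
  If \<open>P\<^sub>x v = 0\<close>, then the order relation gives \<open>\<langle>\<Sum> S\<^sub>e S\<^sub>e\<^sup>* v, v\<rangle> \<le> 0\<close>, hence \<open>S\<^sub>e\<^sup>* v = 0\<close> for every
  edge with range \<open>x\<close>. So \<open>S\<^sub>e\<^sup>* P\<^sub>x = S\<^sub>e\<^sup>*\<close>, and the claim is the adjoint of this.
\<close>

lemma dagger_imp_toeplitz_family:
  assumes G: "wf_digraph G" and dag: "dagger G S P"
  shows "toeplitz_family G S P"
proof -
  interpret wf_digraph G
    by (rule G)
  interpret partial_isometry_family G S P
    using dag by unfold_locales (auto simp: dagger_def partial_isometry_def)
  show ?thesis
  proof unfold_locales
    fix e assume e: "e \<in> arcs G"
    define x where "x = head G e"
    have x: "x \<in> verts G"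
      using e by (simp add: x_def)
    have summable: "sot_summable (\<lambda>e. S e o\<^sub>L adj (S e)) {e \<in> arcs G. head G e = x}"
      and le: "range_sum G S x \<le>\<^sub>o\<^sub>p P x"
      using dag x by (auto simp: dagger_def)
    have ker: "adj (S e) v = 0" if "P x v = 0" for v
    proof -
      have "0 \<le> inner ((P x - range_sum G S x) v) v"
        using le unfolding le_op_def positive_op_def by (simp add: Re_cinner)
      then have "inner (range_sum G S x v) v \<le> 0"
        using that by (simp add: blinfun.diff_left)
      with norm_adj_S_le_range_sum[OF summable e x_def[symmetric], of v]
      have "(norm (adj (S e) v))\<^sup>2 \<le> 0"
        by linarith
      then show ?thesis
        by simp
    qed
    have *: "adj (S e) (P x v) = adj (S e) v" for v
      using ker[of "v - P x v"] x by (simp add: blinfun.diff_right P_P)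
    show "P (head G e) o\<^sub>L S e = S e"
    proof (rule blinfun_eqI)
      fix v
      have "P x (S e v) = S e v"
      proof (rule cinner_eqI)
        fix z
        have "cinner z (P x (S e v)) = cinner (adj (S e) (P x z)) v"
          using x e by (simp add: projection_cinner(1)[OF P_projection] cinner_adj_left S_bops)
        also have "\<dots> = cinner z (S e v)"
          using e by (simp add: * cinner_adj_left S_bops)
        finally show "cinner z (P x (S e v)) = cinner z (S e v)" .
      qed
      then show "(P (head G e) o\<^sub>L S e) v = S e v"
        by (simp add: x_def)
    qed
  qed
qed

text \<open>
  Normalize a non-zero vector of the form \<open>(P\<^sub>x - \<Sum> S\<^sub>e S\<^sub>e\<^sup>*) v\<close>.
\<close>

lemma dagger_wandering_vector:
  assumes G: "wf_digraph G" and dag: "dagger G S P" and x: "x \<in> verts G"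
    and neq: "range_sum G S x \<noteq> P x"
  obtains u where "norm u = 1" "P x u = u" "\<And>e. e \<in> arcs G \<Longrightarrow> adj (S e) u = 0"
proof -
  interpret toeplitz_family G S P
    using G dag by (rule dagger_imp_toeplitz_family)
  have summable: "sot_summable (\<lambda>e. S e o\<^sub>L adj (S e)) {e \<in> arcs G. head G e = x}"
    using dag x by (auto simp: dagger_def)
  obtain v where v: "range_sum G S x v \<noteq> P x v"
    using neq blinfun_eqI by blast
  define w where "w = P x v - range_sum G S x v"
  have "((\<lambda>e. P x (S e (adj (S e) v))) has_sum P x (range_sum G S x v))
      {e \<in> arcs G. head G e = x}"
    by (rule has_sum_bounded_linear[OF blinfun.bounded_linear_right range_sum_has_sum[OF summable]])
  moreover have "((\<lambda>e. P x (S e (adj (S e) v))) has_sum range_sum G S x v)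
      {e \<in> arcs G. head G e = x}"
    using range_sum_has_sum[OF summable, of v] x by (subst has_sum_cong) (auto simp: P_S)
  ultimately have "P x (range_sum G S x v) = range_sum G S x v"
    by (rule has_sum_unique)
  then have Pw: "P x w = w"
    using x by (simp add: w_def blinfun.diff_right P_P)
  have adj_w: "adj (S e) w = 0" if e: "e \<in> arcs G" for e
  proof (cases "head G e = x")
    case True
    then show ?thesis
      using e x by (simp add: w_def blinfun.diff_right adj_S_range_sum[OF summable] adj_S_P)
  next
    case False
    then show ?thesis
      using adj_S_P[OF x e, of w] unfolding Pw by auto
  qed
  have "w \<noteq> 0"
    using v by (simp add: w_def)
  then show ?thesis
    using that[of "(1 / norm w) *\<^sub>R w"] Pw adj_w by (simp add: blinfun.scaleR_right)
qed


section \<open>Isometric graphs of operators\<close>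

text \<open>The graph of an isometric \<open>*\<close>-isomorphism between \<open>*\<close>-subalgebras, given as a set of pairs.\<close>

locale isometric_star_graph =
  fixes \<Gamma> :: "('k::chilbert_space op \<times> 'h::chilbert_space op) set"
  assumes bops_fst: "(T, T') \<in> \<Gamma> \<Longrightarrow> T \<in> bops" and bops_snd: "(T, T') \<in> \<Gamma> \<Longrightarrow> T' \<in> bops"
    and zero: "(0, 0) \<in> \<Gamma>"
    and add: "(T, T') \<in> \<Gamma> \<Longrightarrow> (U, U') \<in> \<Gamma> \<Longrightarrow> (T + U, T' + U') \<in> \<Gamma>"
    and compose: "(T, T') \<in> \<Gamma> \<Longrightarrow> (U, U') \<in> \<Gamma> \<Longrightarrow> (T o\<^sub>L U, T' o\<^sub>L U') \<in> \<Gamma>"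
    and scale: "(T, T') \<in> \<Gamma> \<Longrightarrow> (scale_op c T, scale_op c T') \<in> \<Gamma>"
    and adjoint: "(T, T') \<in> \<Gamma> \<Longrightarrow> (adj T, adj T') \<in> \<Gamma>"
    and norm_eq: "(T, T') \<in> \<Gamma> \<Longrightarrow> norm T' = norm T"
begin

lemma diff: "p \<in> \<Gamma> \<Longrightarrow> q \<in> \<Gamma> \<Longrightarrow> p - q \<in> \<Gamma>"
  using add[of "fst p" "snd p" "- fst q" "- snd q"] scale[of "fst q" "snd q" "- 1"]
  by (simp add: scale_op_minus_one minus_prod_def)

lemma functional: "(T, T') \<in> \<Gamma> \<Longrightarrow> (T, T'') \<in> \<Gamma> \<Longrightarrow> T' = T''"
  using diff[of "(T, T')" "(T, T'')"] norm_eq[of 0 "T' - T''"] by simp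

lemma swap: "isometric_star_graph (prod.swap ` \<Gamma>)"
  by unfold_locales
    (use bops_fst bops_snd zero add compose scale adjoint norm_eq in \<open>auto simp: image_iff Bex_def\<close>)

lemma norm_closure: "(T, T') \<in> closure \<Gamma> \<Longrightarrow> norm T' = norm T"
proof -
  assume TT': "(T, T') \<in> closure \<Gamma>"
  \<comment> \<open>Isometry is contractivity of the graph in both directions.\<close>
  have "(T', T) \<in> closure (prod.swap ` \<Gamma>)"
  proof -
    have "prod.swap (T, T') \<in> closure (prod.swap ` \<Gamma>)"
      by (rule closure_mono_map[OF TT'])
        (auto simp: prod.swap_def intro!: continuous_intros subsetD[OF closure_subset])
    then show ?thesis
      by simp
  qed
  then have "norm T \<le> norm T'"
    by (rule contraction_graph_closure(1)[rotated 2])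
      (use isometric_star_graph.diff[OF swap] isometric_star_graph.norm_eq[OF swap] in \<open>auto\<close>)
  moreover have "norm T' \<le> norm T"
    by (rule contraction_graph_closure(1)[OF _ _ TT']) (auto simp: diff norm_eq)
  ultimately show ?thesis
    by simp
qed

lemma closure_bops: "(T, T') \<in> closure \<Gamma> \<Longrightarrow> T \<in> bops \<and> T' \<in> bops"
proof -
  have "closure \<Gamma> \<subseteq> bops \<times> bops"
    using bops_fst bops_snd by (intro closure_minimal closed_Times closed_bops) auto
  then show "(T, T') \<in> closure \<Gamma> \<Longrightarrow> T \<in> bops \<and> T' \<in> bops"
    by auto
qed

lemma closure_graph: "isometric_star_graph (closure \<Gamma>)"
proof
  fix T T' assume TT': "(T, T') \<in> closure \<Gamma>"
  show b: "T \<in> bops" "T' \<in> bops" "norm T' = norm T"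
    using closure_bops[OF TT'] norm_closure[OF TT'] by auto
  show "(scale_op c T, scale_op c T') \<in> closure \<Gamma>" for c
  proof -
    have "(\<lambda>(T, T'). (scale_op c T, scale_op c T')) (T, T') \<in> closure \<Gamma>"
      by (rule closure_mono_map[OF TT'])
        (auto simp: case_prod_beta intro!: continuous_intros bounded_linear.continuous_on[OF bounded_linear_scale_op]
          subsetD[OF closure_subset] scale)
    then show ?thesis
      by simp
  qed
  show "(adj T, adj T') \<in> closure \<Gamma>"
  proof -
    obtain p where p: "\<And>n. p n \<in> \<Gamma>" "p \<longlonglongrightarrow> (T, T')"
      using TT' by (auto simp: closure_sequential)
    have mem: "(fst (p n), snd (p n)) \<in> \<Gamma>" for n
      using p(1)[of n] by simp
    have "(\<lambda>n. adj (fst (p n))) \<longlonglongrightarrow> adj T" "(\<lambda>n. adj (snd (p n))) \<longlonglongrightarrow> adj T'"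
      using tendsto_fst[OF p(2)] tendsto_snd[OF p(2)] bops_fst[OF mem] bops_snd[OF mem] b
      by (auto intro: tendsto_adj)
    then have "(\<lambda>n. (adj (fst (p n)), adj (snd (p n)))) \<longlonglongrightarrow> (adj T, adj T')"
      by (intro tendsto_Pair)
    then show ?thesis
      unfolding closure_sequential using adjoint[OF mem]
      by (intro exI[of _ "\<lambda>n. (adj (fst (p n)), adj (snd (p n)))"]) simp
  qed
  fix U U' assume UU': "(U, U') \<in> closure \<Gamma>"
  show "(T + U, T' + U') \<in> closure \<Gamma>"
  proof -
    have "(\<lambda>p q. (fst p + fst q, snd p + snd q)) (T, T') (U, U') \<in> closure \<Gamma>"
      by (rule closure_closed_under[OF TT' UU'])
        (auto simp: case_prod_beta intro!: continuous_intros add)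
    then show ?thesis
      by simp
  qed
  show "(T o\<^sub>L U, T' o\<^sub>L U') \<in> closure \<Gamma>"
  proof -
    have "(\<lambda>p q. (fst p o\<^sub>L fst q, snd p o\<^sub>L snd q)) (T, T') (U, U') \<in> closure \<Gamma>"
      by (rule closure_closed_under[OF TT' UU'])
        (auto simp: case_prod_beta intro!: continuous_intros
          bounded_bilinear.continuous_on[OF bounded_bilinear_blinfun_compose] compose)
    then show ?thesis
      by simp
  qed
next
  show "(0, 0) \<in> closure \<Gamma>"
    using zero by (rule subsetD[OF closure_subset])
qed

lemma fst_image: "T \<in> fst ` \<Gamma> \<longleftrightarrow> (\<exists>T'. (T, T') \<in> \<Gamma>)"
  by force

lemma cstar_subalgebra_fst:
  assumes "closed \<Gamma>"
  shows "cstar_subalgebra (fst ` \<Gamma>)"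
proof -
  have "closure (fst ` \<Gamma>) \<subseteq> fst ` \<Gamma>"
    using contraction_graph_closure(2)[of \<Gamma>, OF diff] norm_eq closure_closed[OF assms]
    by (auto simp: fst_image)
  then have "closed (fst ` \<Gamma>)"
    by (rule closure_subset_eq[THEN iffD1])
  moreover have "fst ` \<Gamma> \<subseteq> bops"
    using bops_fst by auto
  moreover have "T + U \<in> fst ` \<Gamma>" "T o\<^sub>L U \<in> fst ` \<Gamma>" if "T \<in> fst ` \<Gamma>" "U \<in> fst ` \<Gamma>" for T U
    using that unfolding fst_image by (blast intro: add compose)+
  moreover have "scale_op c T \<in> fst ` \<Gamma>" "adj T \<in> fst ` \<Gamma>" if "T \<in> fst ` \<Gamma>" for T c
    using that unfolding fst_image by (blast intro: scale adjoint)+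
  moreover have "0 \<in> fst ` \<Gamma>"
    using zero unfolding fst_image by blast
  ultimately show ?thesis
    unfolding cstar_subalgebra_def subalgebra_def by (intro conjI ballI allI) simp_all
qed

lemma isomorphism:
  obtains \<phi> where "star_hom (fst ` \<Gamma>) (snd ` \<Gamma>) \<phi>" "bij_betw \<phi> (fst ` \<Gamma>) (snd ` \<Gamma>)"
    "\<And>T T'. (T, T') \<in> \<Gamma> \<Longrightarrow> \<phi> T = T'"
proof -
  define \<phi> where "\<phi> T = (THE T'. (T, T') \<in> \<Gamma>)" for T
  have \<phi>: "\<phi> T = T'" if "(T, T') \<in> \<Gamma>" for T T'
    unfolding \<phi>_def using that functional by blast
  have inj: "T = U" if "(T, T') \<in> \<Gamma>" "(U, T') \<in> \<Gamma>" for T U T'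
    using isometric_star_graph.functional[OF swap, of T' T U] that by (force simp: image_iff)
  have "bij_betw \<phi> (fst ` \<Gamma>) (snd ` \<Gamma>)"
    unfolding bij_betw_def inj_on_def
  proof (intro conjI ballI impI)
    fix T U assume "T \<in> fst ` \<Gamma>" "U \<in> fst ` \<Gamma>" "\<phi> T = \<phi> U"
    then show "T = U"
      using inj by (auto simp: \<phi>)
  next
    show "\<phi> ` fst ` \<Gamma> = snd ` \<Gamma>"
      unfolding image_image by (rule image_cong) (auto simp: \<phi>)
  qed
  moreover have "star_hom (fst ` \<Gamma>) (snd ` \<Gamma>) \<phi>"
    unfolding star_hom_def
  proof (intro conjI ballI allI)
    show "\<phi> \<in> fst ` \<Gamma> \<rightarrow> snd ` \<Gamma>"
      by (force simp: \<phi>)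
  next
    fix T U assume "T \<in> fst ` \<Gamma>" "U \<in> fst ` \<Gamma>"
    then obtain T' U' where "(T, T') \<in> \<Gamma>" "(U, U') \<in> \<Gamma>"
      by (auto simp: fst_image)
    then show "\<phi> (T + U) = \<phi> T + \<phi> U" "\<phi> (T o\<^sub>L U) = \<phi> T o\<^sub>L \<phi> U"
      by (simp_all add: \<phi> \<phi>[OF add] \<phi>[OF compose])
  next
    fix c T assume "T \<in> fst ` \<Gamma>"
    then obtain T' where "(T, T') \<in> \<Gamma>"
      by (auto simp: fst_image)
    then show "\<phi> (scale_op c T) = scale_op c (\<phi> T)"
      by (simp add: \<phi> \<phi>[OF scale])
  next
    fix T assume "T \<in> fst ` \<Gamma>"
    then obtain T' where "(T, T') \<in> \<Gamma>"
      by (auto simp: fst_image)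
    then show "\<phi> (adj T) = adj (\<phi> T)"
      by (simp add: \<phi> \<phi>[OF adjoint])
  qed
  ultimately show ?thesis
    using that \<phi> by blast
qed

end


section \<open>The generated algebras\<close>

lemma cstar_subalgebraD:
  assumes "cstar_subalgebra A"
  shows "0 \<in> A" "R \<in> A \<Longrightarrow> T \<in> A \<Longrightarrow> R + T \<in> A" "R \<in> A \<Longrightarrow> T \<in> A \<Longrightarrow> R o\<^sub>L T \<in> A"
    "T \<in> A \<Longrightarrow> scale_op c T \<in> A" "T \<in> A \<Longrightarrow> adj T \<in> A" "closed A"
  using assms by (auto simp: cstar_subalgebra_def subalgebra_def)

context toeplitz_family
begin

lemma word_op_vertex: "word_op S P x [] [] = P x"
  by (auto simp: word_op_def adj_id intro!: blinfun_eqI)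

lemma word_op_edge: "e \<in> arcs G \<Longrightarrow> word_op S P (tail G e) [e] [] = S e"
  by (auto simp: word_op_def adj_id S_P intro!: blinfun_eqI)

lemma combination_op_in_cstar_subalgebra:
  assumes A: "cstar_subalgebra A"
    and gen: "\<And>e. e \<in> arcs G \<Longrightarrow> S e \<in> A" "\<And>x. x \<in> verts G \<Longrightarrow> P x \<in> A"
    and js: "combination_in G js"
  shows "combination_op S P js \<in> A"
proof -
  note A' = cstar_subalgebraD[OF A]
  have path: "path_op S p o\<^sub>L T \<in> A" if "set p \<subseteq> arcs G" "T \<in> A" for p T
    using that by (induction p arbitrary: T) (simp_all add: blinfun_compose_assoc A'(3) gen)
  have "word_op S P x p q \<in> A" if "x \<in> verts G" "set p \<subseteq> arcs G" "set q \<subseteq> arcs G" for x p q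
  proof -
    have "adj (path_op S q o\<^sub>L P x) = P x o\<^sub>L adj (path_op S q)"
      using that projectionD(3)[OF P_projection] by (simp add: adj_compose path_op_bops P_bops)
    then have "P x o\<^sub>L adj (path_op S q) \<in> A"
      using A'(5)[OF path] that gen by metis
    then show ?thesis
      unfolding word_op_def blinfun_compose_assoc using that by (intro path)
  qed
  with js show ?thesis
  proof (induction js)
    case (Cons j js)
    then show ?case
      by (cases j) (simp add: A'(2) A'(4))
  qed (simp add: A')
qed

end

context toeplitz_pair
begin

lemma word_graph_edge: "e \<in> arcs G \<Longrightarrow> (L e, S e) \<in> word_graph"
  using word_graph_word[of "tail G e" "[e]" "[]"] by (simp add: L.word_op_edge S.word_op_edge)

lemma word_graph_vertex: "x \<in> verts G \<Longrightarrow> (R x, P x) \<in> word_graph"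
  using word_graph_word[of x "[]" "[]"] by (simp add: L.word_op_vertex S.word_op_vertex)

end

context fock_space_pair
begin

lemma isometric_star_graph_word_graph:
  assumes "no_sinks G"
  shows "isometric_star_graph word_graph"
proof
  fix T T' assume TT': "(T, T') \<in> word_graph"
  show "T \<in> bops" "T' \<in> bops"
    using TT' by (auto elim!: word_graphE intro: combination_op_bops S.combination_op_bops)
  show "norm T' = norm T" "(adj T, adj T') \<in> word_graph"
    "(scale_op c T, scale_op c T') \<in> word_graph" for c
    using TT' by (rule norm_word_graph word_graph_adj word_graph_scale)+
  fix U U' assume "(U, U') \<in> word_graph"
  with TT' show "(T + U, T' + U') \<in> word_graph" "(T o\<^sub>L U, T' o\<^sub>L U') \<in> word_graph"
    by (rule word_graph_add word_graph_compose[OF assms])+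
qed (rule word_graph_zero)

text \<open>
  The first projection of the closed graph is complete because the graph is isometric. This makes
  it the smallest \<open>C\<^sup>*\<close>-algebra containing the generators.
\<close>

lemma fst_closure_word_graph:
  assumes "no_sinks G"
  shows "fst ` closure word_graph = cstar_gen (quiver_algebra G \<xi>)"
proof -
  interpret W: isometric_star_graph "closure word_graph"
    by (intro isometric_star_graph.closure_graph isometric_star_graph_word_graph assms)
  have alg: "cstar_subalgebra (fst ` closure word_graph)"
    by (rule W.cstar_subalgebra_fst) simp
  have "L e \<in> fst ` closure word_graph" if "e \<in> arcs G" for e
    using imageI[OF subsetD[OF closure_subset word_graph_edge[OF that]], of fst] by simp
  moreover have "R x \<in> fst ` closure word_graph" if "x \<in> verts G" for x
    using imageI[OF subsetD[OF closure_subset word_graph_vertex[OF that]], of fst] by simp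
  ultimately have gen: "L ` arcs G \<union> R ` verts G \<subseteq> fst ` closure word_graph"
    by blast
  show ?thesis
    unfolding cstar_gen_def
  proof (rule hull_unique[symmetric])
    show "quiver_algebra G \<xi> \<subseteq> fst ` closure word_graph"
      unfolding quiver_algebra_def closed_algebra_gen_def
      using alg gen by (intro hull_minimal) (auto simp: cstar_subalgebra_def)
    show "cstar_subalgebra (fst ` closure word_graph)"
      by (rule alg)
    fix A assume sub: "quiver_algebra G \<xi> \<subseteq> A" and A: "cstar_subalgebra A"
    have "L ` arcs G \<union> R ` verts G \<subseteq> A"
      using sub unfolding quiver_algebra_def closed_algebra_gen_def
      by (rule order_trans[OF hull_subset])
    then have "combination_op L R js \<in> A" if "combination_in G js" for js
      using that by (intro combination_op_in_cstar_subalgebra[OF A]) auto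
    then have "word_graph \<subseteq> fst -` A"
      by (auto simp: word_graph_def)
    then have "closure word_graph \<subseteq> fst -` A"
      using cstar_subalgebraD(6)[OF A]
      by (intro closure_minimal closed_vimage continuous_intros) auto
    then show "fst ` closure word_graph \<subseteq> A"
      by auto
  qed
qed

text \<open>
  On this side the vertex projections are not among the generators, but \<open>P\<^sub>x = S\<^sub>e\<^sup>* S\<^sub>e\<close> for an edge \<open>e\<close>
  with source \<open>x\<close>.
\<close>

lemma snd_closure_word_graph:
  assumes "no_sinks G"
  shows "snd ` closure word_graph = cstar_gen (S ` arcs G)"
proof -
  interpret W: isometric_star_graph "closure word_graph"
    by (intro isometric_star_graph.closure_graph isometric_star_graph_word_graph assms)
  have "closed (prod.swap ` closure word_graph)"
  proof -
    have "prod.swap ` closure word_graph = prod.swap -` closure word_graph"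
      by force
    also have "closed \<dots>"
      by (intro closed_vimage) (auto simp: prod.swap_def intro!: continuous_intros)
    finally show ?thesis .
  qed
  then have "cstar_subalgebra (fst ` prod.swap ` closure word_graph)"
    by (rule isometric_star_graph.cstar_subalgebra_fst[OF W.swap])
  then have alg: "cstar_subalgebra (snd ` closure word_graph)"
    by (simp add: image_image)
  show ?thesis
    unfolding cstar_gen_def
  proof (rule hull_unique[symmetric])
    have "S e \<in> snd ` closure word_graph" if "e \<in> arcs G" for e
      using imageI[OF subsetD[OF closure_subset word_graph_edge[OF that]], of snd] by simp
    then show "S ` arcs G \<subseteq> snd ` closure word_graph"
      by blast
    show "cstar_subalgebra (snd ` closure word_graph)"
      by (rule alg)
    fix A assume sub: "S ` arcs G \<subseteq> A" and A: "cstar_subalgebra A"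
    have P: "P x \<in> A" if x: "x \<in> verts G" for x
    proof -
      obtain e where e: "e \<in> arcs G" "tail G e = x"
        using assms x unfolding no_sinks_def by blast
      then have "adj (S e) o\<^sub>L S e \<in> A"
        using sub by (intro cstar_subalgebraD[OF A]) auto
      then show ?thesis
        using e S.S_initial[OF e(1)] by simp
    qed
    then have "combination_op S P js \<in> A" if "combination_in G js" for js
      using that sub by (intro S.combination_op_in_cstar_subalgebra[OF A]) auto
    then have "word_graph \<subseteq> snd -` A"
      by (auto simp: word_graph_def)
    then have "closure word_graph \<subseteq> snd -` A"
      using cstar_subalgebraD(6)[OF A]
      by (intro closure_minimal closed_vimage continuous_intros) auto
    then show "snd ` closure word_graph \<subseteq> A"
      by auto
  qed
qed

end

theorem theorem7p7:
  fixes G :: "('v, 'e) pre_digraph"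
    and \<xi> :: "('v, 'e) path \<Rightarrow> 'k::chilbert_space"
    and S' :: "'e \<Rightarrow> 'h::chilbert_space op"
    and P' :: "'v \<Rightarrow> 'h op"
  assumes "wf_digraph G" and "countable (verts G)" and "countable (arcs G)"
    and "no_sources G" and "no_sinks G"
    and "orthonormal_basis \<xi> (free_semigroupoid G)"
    and "dagger G S' P'"
    and "\<forall>x\<in>verts G. range_sum G S' x \<noteq> P' x"
  shows "(\<exists>\<phi>. star_hom (cstar_gen (quiver_algebra G \<xi>)) bops \<phi> \<and>
             inj_on \<phi> (cstar_gen (quiver_algebra G \<xi>)) \<and>
             (\<forall>e\<in>arcs G. \<phi> (creation_op G \<xi> e) = S' e)) \<and>
         cstar_isomorphic (cstar_gen (S' ` arcs G)) (cstar_gen (quiver_algebra G \<xi>))"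
proof -
  have "\<exists>u. norm u = 1 \<and> P' x u = u \<and> (\<forall>e\<in>arcs G. adj (S' e) u = 0)" if "x \<in> verts G" for x
    using dagger_wandering_vector[OF assms(1,7) that] assms(8) that by metis
  then obtain \<eta> where \<eta>: "\<And>x. x \<in> verts G \<Longrightarrow>
      norm (\<eta> x) = 1 \<and> P' x (\<eta> x) = \<eta> x \<and> (\<forall>e\<in>arcs G. adj (S' e) (\<eta> x) = 0)"
    by metis
  interpret S: toeplitz_family G S' P'
    using assms(1,7) by (rule dagger_imp_toeplitz_family)
  interpret fock_space_pair G \<xi> S' P' \<eta>
    by unfold_locales (use assms(6) \<eta> in auto)
  let ?\<Gamma> = "closure word_graph"
  interpret W: isometric_star_graph ?\<Gamma>
    by (intro isometric_star_graph.closure_graph isometric_star_graph_word_graph assms(5))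
  note fst = fst_closure_word_graph[OF assms(5)] and snd = snd_closure_word_graph[OF assms(5)]
  obtain \<phi> where \<phi>: "star_hom (fst ` ?\<Gamma>) (snd ` ?\<Gamma>) \<phi>" "bij_betw \<phi> (fst ` ?\<Gamma>) (snd ` ?\<Gamma>)"
    "\<And>T T'. (T, T') \<in> ?\<Gamma> \<Longrightarrow> \<phi> T = T'"
    using W.isomorphism by blast
  have "snd ` ?\<Gamma> \<subseteq> bops"
    using W.bops_snd by auto
  then have "star_hom (fst ` ?\<Gamma>) bops \<phi>"
    using \<phi>(1) unfolding star_hom_def by blast
  moreover have "inj_on \<phi> (fst ` ?\<Gamma>)"
    using \<phi>(2) by (rule bij_betw_imp_inj_on)
  moreover have "\<phi> (creation_op G \<xi> e) = S' e" if "e \<in> arcs G" for e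
    by (intro \<phi>(3) subsetD[OF closure_subset] word_graph_edge that)
  moreover have "cstar_isomorphic (snd ` ?\<Gamma>) (fst ` ?\<Gamma>)"
  proof -
    obtain \<psi> where "star_hom (fst ` prod.swap ` ?\<Gamma>) (snd ` prod.swap ` ?\<Gamma>) \<psi>"
      "bij_betw \<psi> (fst ` prod.swap ` ?\<Gamma>) (snd ` prod.swap ` ?\<Gamma>)"
      by (rule isometric_star_graph.isomorphism[OF W.swap]) (rule that)
    then show ?thesis
      unfolding cstar_isomorphic_def by (auto simp: image_image)
  qed
  ultimately show ?thesis
    unfolding fst snd by blast
qed

end
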